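(* Let $\Gamma=\mathrm{PSL}_2(\mathbb Z)$ act on the upper half-plane $\mathbf H^2$ by Möbius transformations, let $\Omega=\Gamma e^{i\pi/3}$, let $\mathrm{phi}(\Omega)$ be the group of all piecewise $\Gamma$-isometric permutations of $\Omega$, and let $\Sigma_\infty(\Omega)$ be its normal subgroup consisting of all permutations of $\Omega$ with finite support. Then $\mathrm{phi}(\Omega)/\Sigma_\infty(\Omega)$ is isomorphic to Richard Thompson's group $V$.
   Context: Let $H=\{z\in\mathbf H^2:|z|\ge1\}$, $H'=\{z\in\mathbf H^2:\mathrm{Re}(z)\le\frac12\}$, $H''=\{z\in\mathbf H^2:\mathrm{Re}(z)\ge-\frac12\}$. A convex $\Gamma$-polyhedral subset of $\mathbf H^2$ is a finite intersection of $\Gamma$-translates of $H,H',H''$. A convex $\Gamma$-polyhedral piece of $\Omega$ is a set $\Omega\cap P$ with $P$ convex $\Gamma$-polyhedral. $\mathrm{phi}(\Omega)$ is the group of all permutations $g$ of $\Omega$ such that $\Omega$ is a union of finitely many convex $\Gamma$-polyhedral pieces $S_1,\dots,S_k$ such that, for each $i$, $g|_{S_i}$ is the restriction of some element of $\Gamma$. Thompson's group $V$ is the group of homeomorphisms of the Cantor set $\{0,1\}^{\mathbb N}$ (the boundary of the rooted infinite binary tree) of the form $u_iw\mapsto v_iw$ ($1\le i\le k$), where $\{u_1,\dots,u_k\}$ and $\{v_1,\dots,v_k\}$ are complete finite prefix codes of words in $\{0,1\}$. *)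

theory Defs
  imports
    "HOL-Analysis.Analysis"
    "HOL-Algebra.Bij"
    "HOL-Algebra.Coset"
    "HOL-Library.Sublist"
    "HOL-Library.Omega_Words_Fun"
begin

section \<open>The modular group acting on the upper half-plane\<close>

definition upper_half_plane :: "complex set" where
  "upper_half_plane = {z. Im z > 0}"

definition moebius :: "int^2^2 \<Rightarrow> complex \<Rightarrow> complex" where
  "moebius A z =
     (of_int (A $ 1 $ 1) * z + of_int (A $ 1 $ 2)) / (of_int (A $ 2 $ 1) * z + of_int (A $ 2 $ 2))"

text \<open>The group $PSL_2(Z)$ acts faithfully on the upper half-plane: two matrices in $SL_2(Z)$ induce
  the same map iff they agree up to sign. We identify it with the group of transformations it induces
  (extensional functions on the upper half-plane).\<close>

definition PSL2Z :: "(complex \<Rightarrow> complex) set" where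
  "PSL2Z = {restrict (moebius A) upper_half_plane | A. det A = 1}"

definition Omega :: "complex set" where
  "Omega = {\<gamma> (exp (\<i> * of_real (pi / 3))) | \<gamma>. \<gamma> \<in> PSL2Z}"


section \<open>Piecewise isometric permutations\<close>

definition half_plane :: "complex set" where
  "half_plane = {z \<in> upper_half_plane. cmod z \<ge> 1}"

definition half_plane' :: "complex set" where
  "half_plane' = {z \<in> upper_half_plane. Re z \<le> 1 / 2}"

definition half_plane'' :: "complex set" where
  "half_plane'' = {z \<in> upper_half_plane. Re z \<ge> - (1 / 2)}"

definition half_plane_translates :: "complex set set" where
  "half_plane_translates =
     {\<gamma> ` K | \<gamma> K. \<gamma> \<in> PSL2Z \<and> K \<in> {half_plane, half_plane', half_plane''}}"

text \<open>The empty intersection is the whole upper half-plane.\<close>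

definition convex_polyhedral :: "complex set \<Rightarrow> bool" where
  "convex_polyhedral P \<longleftrightarrow>
     (\<exists>\<F>. finite \<F> \<and> \<F> \<subseteq> half_plane_translates \<and> P = upper_half_plane \<inter> \<Inter>\<F>)"

definition convex_polyhedral_piece :: "complex set \<Rightarrow> complex set \<Rightarrow> bool" where
  "convex_polyhedral_piece X S \<longleftrightarrow> (\<exists>P. convex_polyhedral P \<and> S = X \<inter> P)"

definition piecewise_isometric :: "complex set \<Rightarrow> (complex \<Rightarrow> complex) \<Rightarrow> bool" where
  "piecewise_isometric X g \<longleftrightarrow>
     (\<exists>\<S>. finite \<S> \<and> (\<forall>S\<in>\<S>. convex_polyhedral_piece X S) \<and> X = \<Union>\<S> \<and>
          (\<forall>S\<in>\<S>. \<exists>\<gamma>\<in>PSL2Z. \<forall>z\<in>S. g z = \<gamma> z))"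

definition phi :: "complex set \<Rightarrow> (complex \<Rightarrow> complex) monoid" where
  "phi X = (BijGroup X)\<lparr>carrier := {g \<in> Bij X. piecewise_isometric X g}\<rparr>"

definition finitely_supported_perms :: "'a set \<Rightarrow> ('a \<Rightarrow> 'a) set" where
  "finitely_supported_perms X = {g \<in> Bij X. finite {x \<in> X. g x \<noteq> x}}"


section \<open>Thompson's group V\<close>

text \<open>Words are boolean lists, points of the Cantor set are functions \<^typ>\<open>nat \<Rightarrow> bool\<close>, which carry the
  product topology.\<close>

definition complete_prefix_code :: "bool list set \<Rightarrow> bool" where
  "complete_prefix_code U \<longleftrightarrow>
     finite U \<and> (\<forall>u\<in>U. \<forall>v\<in>U. Sublist.prefix u v \<longrightarrow> u = v) \<and>
     (\<forall>x :: bool word. \<exists>u\<in>U. \<exists>w. x = u \<frown> w)"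

definition prefix_replacement :: "(bool word \<Rightarrow> bool word) \<Rightarrow> bool" where
  "prefix_replacement f \<longleftrightarrow>
     (\<exists>us vs. length us = length vs \<and> distinct us \<and> distinct vs \<and>
        complete_prefix_code (set us) \<and> complete_prefix_code (set vs) \<and>
        (\<forall>i<length us. \<forall>w. f (us ! i \<frown> w) = vs ! i \<frown> w))"

definition Thompson_V :: "(bool word \<Rightarrow> bool word) monoid" where
  "Thompson_V = (BijGroup UNIV)\<lparr>carrier :=
     {f. (\<exists>f'. homeomorphism UNIV UNIV f f') \<and> prefix_replacement f}\<rparr>"

end

theory Submission
  imports Defs
begin

text \<open>The orbit Omega is the vertex set of a trivalent tree. Removing the edge through the fixed point i of
  -1 / z leaves two rooted binary trees, so that Omega is identified with the nonempty binary words and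
  the set of ends of the tree with the Cantor set. Since PSL2(Z) is generated by -1 / z and z + 1, each
  of its elements acts on all sufficiently long words by replacing a prefix. Every half-plane contains
  or misses every cone (the vertices below a given one) of sufficient depth, and conversely every cone is
  a union of two polyhedral pieces; hence phi(Omega) becomes the group of the permutations of the nonempty
  words that preserve the tail of every long word. Such a permutation induces an element of V on
  infinite words, and the kernel of this homomorphism consists of the finitely supported permutations.
  It is onto because a complete prefix code with n elements has exactly n - 1 words as proper prefixes, so that a
  bijection between two codes of the same size extends to the remaining words.\<close>

section \<open>Tail-preserving permutations of finite words\<close>

text \<open>The first letter of a word is the last map applied, so appending letters moves deeper
  into the tree and the cone below a word is the image of a whole half tree under a single modular
  map. An isometry need not respect the removed edge, but it can disturb only a bounded initial
  segment of a word; everything after it is carried along unchanged. Every finiteness condition is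
  expressed by one threshold on word lengths that is uniform over the tree. Thresholds add under
  composition, and over a finite alphabet "all but finitely many words" means the same as "all
  sufficiently long words". The empty word stands for the removed edge rather than for a vertex. It
  is an inner node of both codes in the surjectivity argument, so taking it out on both sides keeps
  the numbers of leftover words equal; an imbalance there would be an index obstructing the
  extension to a permutation. The pieces in the definition of phi(Omega) may overlap, so coverings
  are enough and no partition has to be constructed.\<close>

definition tail_preserving_from :: "nat \<Rightarrow> ('a list \<Rightarrow> 'a list) \<Rightarrow> bool" where
  "tail_preserving_from N s \<longleftrightarrow> (\<forall>u w. N \<le> length u \<longrightarrow> s (u @ w) = s u @ w)"

lemma tail_preserving_fromD:
  "tail_preserving_from N s \<Longrightarrow> N \<le> length u \<Longrightarrow> s (u @ w) = s u @ w"
  by (simp add: tail_preserving_from_def)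

text \<open>All letters after the first \<open>N\<close> survive in the image, so at most
  \<open>N\<close> letters are lost. This bound makes thresholds add under composition and keeps
  images of deep cones deep.\<close>

lemma tail_preserving_from_length:
  assumes "tail_preserving_from N s" "N \<le> length u"
  shows "length u \<le> length (s u) + N"
proof -
  have "s (take N u @ drop N u) = s (take N u) @ drop N u"
    using assms by (intro tail_preserving_fromD) auto
  then show ?thesis by simp
qed

lemma tail_preserving_from_comp:
  assumes s: "tail_preserving_from N s" and t: "tail_preserving_from M t"
  shows "tail_preserving_from (N + M) (s \<circ> t)"
  unfolding tail_preserving_from_def
proof (intro allI impI)
  fix u w :: "'a list" assume u: "N + M \<le> length u"
  then have "N \<le> length (t u)"
    using tail_preserving_from_length[OF t, of u] by linarith
  with u show "(s \<circ> t) (u @ w) = (s \<circ> t) u @ w"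
    by (simp add: tail_preserving_fromD[OF s] tail_preserving_fromD[OF t])
qed

lemma finite_short_words: "finite {u :: 'a::finite list. length u < N}"
proof -
  have "{u :: 'a list. length u < N} \<subseteq> {u. set u \<subseteq> UNIV \<and> length u \<le> N}" by auto
  then show ?thesis
    using finite_lists_length_le[of "UNIV :: 'a set" N] finite_subset by auto
qed

lemma finite_word_set_bounded:
  assumes "finite (A :: 'a list set)"
  obtains N where "\<And>u. u \<in> A \<Longrightarrow> length u < N"
proof
  show "length u < Suc (Max (length ` A))" if "u \<in> A" for u
    using assms that by (simp add: less_Suc_eq_le)
qed

text \<open>Here the finiteness of the alphabet enters: only finitely many words are shorter than
  \<open>N\<close>. Choosing \<open>M\<close> above the lengths of all their images forces a word of
  length at least \<open>M\<close> to have its preimage in the range where \<open>s\<close> keeps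
  tails.\<close>

lemma tail_preserving_from_inv:
  fixes s :: "'a::finite list \<Rightarrow> 'a list"
  assumes s: "tail_preserving_from N s" and bij: "bij s"
  obtains M where "tail_preserving_from M (inv_into UNIV s)"
proof -
  obtain M where M: "\<And>u. u \<in> s ` {u. length u < N} \<Longrightarrow> length u < M"
    using finite_word_set_bounded[OF finite_imageI[OF finite_short_words]] by blast
  have "tail_preserving_from M (inv_into UNIV s)"
    unfolding tail_preserving_from_def
  proof (intro allI impI)
    fix v w :: "'a list" assume v: "M \<le> length v"
    obtain u where u: "v = s u" using bij by (metis bij_pointE)
    have "N \<le> length u" using M[of v] v u by force
    then have "v @ w = s (u @ w)" using u by (simp add: tail_preserving_fromD[OF s])
    then show "inv_into UNIV s (v @ w) = inv_into UNIV s v @ w"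
      using u bij by (simp add: bij_is_inj)
  qed
  then show thesis by (rule that)
qed

text \<open>Fixing the empty word lets permutations of the nonempty words be treated as total maps.\<close>

definition word_perms :: "('a list \<Rightarrow> 'a list) set" where
  "word_perms = {s. bij s \<and> s [] = [] \<and> (\<exists>N. tail_preserving_from N s)}"

lemma word_perms_comp:
  assumes "s \<in> word_perms" "t \<in> word_perms"
  shows "s \<circ> t \<in> word_perms"
  using assms bij_comp[of t s] tail_preserving_from_comp[of _ s _ t]
  by (fastforce simp: word_perms_def)

lemma word_perms_inv:
  fixes s :: "'a::finite list \<Rightarrow> 'a list"
  assumes "s \<in> word_perms" shows "inv_into UNIV s \<in> word_perms"
proof -
  obtain N where "bij s" "s [] = []" "tail_preserving_from N s"
    using assms by (auto simp: word_perms_def)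
  then show ?thesis
    using tail_preserving_from_inv[of N s] by (auto simp: word_perms_def bij_imp_bij_inv inv_f_eq bij_is_inj)
qed

lemma word_perms_id: "id \<in> word_perms"
  by (auto simp: word_perms_def tail_preserving_from_def)

text \<open>Beyond the longest moved word \<open>s\<close> is the identity and keeps tails. This
  later places the finitely supported permutations inside phi(Omega).\<close>

lemma word_perms_if_finite_support:
  fixes s :: "'a list \<Rightarrow> 'a list"
  assumes "bij s" "s [] = []" "finite {w. s w \<noteq> w}"
  shows "s \<in> word_perms"
proof -
  obtain N where N: "\<And>u. u \<in> {w. s w \<noteq> w} \<Longrightarrow> length u < N"
    using finite_word_set_bounded[OF assms(3)] by blast
  then have "s u = u" if "N \<le> length u" for u using that by force
  then have "tail_preserving_from N s" by (simp add: tail_preserving_from_def)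
  with assms show ?thesis by (auto simp: word_perms_def)
qed


section \<open>The action on infinite words\<close>

text \<open>Taking the least threshold makes the value a function of \<open>s\<close> alone; it is
  meaningful only if some threshold exists. By \<open>boundary_map_conc\<close> every other
  threshold gives the same result.\<close>

definition boundary_map :: "('a list \<Rightarrow> 'a list) \<Rightarrow> 'a word \<Rightarrow> 'a word" where
  "boundary_map s x =
     (let N = LEAST N. tail_preserving_from N s in s (x[0 \<rightarrow> N]) \<frown> suffix N x)"

lemma boundary_map_conc:
  assumes s: "tail_preserving_from N s" and u: "N \<le> length u"
  shows "boundary_map s (u \<frown> x) = s u \<frown> x"
proof -
  define M where "M = (LEAST N. tail_preserving_from N s)"
  have M: "tail_preserving_from M s" "M \<le> N"
    using s unfolding M_def by (auto intro: LeastI Least_le)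
  then have *: "M \<le> length u" using u by simp
  have "boundary_map s (u \<frown> x) = s (take M u) \<frown> (drop M u \<frown> x)"
    using * by (simp add: boundary_map_def Let_def flip: M_def)
  also have "\<dots> = (s (take M u) @ drop M u) \<frown> x" by (rule conc_conc)
  also have "s (take M u) @ drop M u = s (take M u @ drop M u)"
    using * by (intro tail_preserving_fromD[OF M(1), symmetric]) auto
  finally show ?thesis by simp
qed

lemma boundary_map_comp:
  fixes s t :: "'a list \<Rightarrow> 'a list"
  assumes s: "tail_preserving_from N s" and t: "tail_preserving_from M t"
  shows "boundary_map (s \<circ> t) = boundary_map s \<circ> boundary_map t"
proof
  fix x :: "'a word"
  obtain u y where x: "x = u \<frown> y" "length u = N + M" by (rule word_split)
  then have "N \<le> length (t u)" using tail_preserving_from_length[OF t, of u] by linarith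
  with x show "boundary_map (s \<circ> t) x = (boundary_map s \<circ> boundary_map t) x"
    by (simp add: boundary_map_conc[OF s] boundary_map_conc[OF t]
        boundary_map_conc[OF tail_preserving_from_comp[OF s t]])
qed

lemma boundary_map_comp_word_perms:
  "s \<in> word_perms \<Longrightarrow> t \<in> word_perms \<Longrightarrow> boundary_map (s \<circ> t) = boundary_map s \<circ> boundary_map t"
  by (auto simp: word_perms_def boundary_map_comp)

lemma boundary_map_id: "boundary_map id = id"
proof
  fix x :: "'a word"
  have "tail_preserving_from 0 (id :: 'a list \<Rightarrow> _)" by (simp add: tail_preserving_from_def)
  from boundary_map_conc[OF this, of "[]" x] show "boundary_map id x = id x" by simp
qed

lemma word_perms_inv_comp:
  "s \<in> word_perms \<Longrightarrow> s \<circ> inv_into UNIV s = id" "s \<in> word_perms \<Longrightarrow> inv_into UNIV s \<circ> s = id"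
  by (auto simp: word_perms_def bij_def surj_iff inj_iff)

lemma boundary_map_inv:
  fixes s :: "'a::finite list \<Rightarrow> 'a list"
  assumes "s \<in> word_perms"
  shows "boundary_map s \<circ> boundary_map (inv_into UNIV s) = id" "boundary_map (inv_into UNIV s) \<circ> boundary_map s = id"
  using boundary_map_comp_word_perms[OF assms word_perms_inv[OF assms]]
    boundary_map_comp_word_perms[OF word_perms_inv[OF assms] assms]
  by (simp_all add: boundary_map_id word_perms_inv_comp assms)

lemma boundary_map_bij:
  fixes s :: "'a::finite list \<Rightarrow> 'a list"
  assumes "s \<in> word_perms" shows "bij (boundary_map s)"
  using boundary_map_inv[OF assms] o_bij by blast

text \<open>If \<open>v\<close> were longer, a constant tail differing from the letter of
  \<open>v\<close> just past the end of \<open>u\<close> would separate the two sides. This needs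
  two letters: over a one-letter alphabet all infinite words coincide.\<close>

lemma conc_eq_imp_eq:
  fixes u v :: "bool list"
  assumes eq: "\<And>x. u \<frown> x = v \<frown> x" shows "u = v"
proof -
  have shorter: "length v \<le> length u"
    if eq: "\<And>x. u \<frown> x = v \<frown> x" for u v :: "bool list"
  proof (rule ccontr)
    assume less: "\<not> length v \<le> length u"
    define b where "b = v ! length u"
    have "(u \<frown> (\<lambda>_. \<not> b)) (length u) = (v \<frown> (\<lambda>_. \<not> b)) (length u)" using eq by simp
    with less show False by (simp add: b_def)
  qed
  have "length u = length v" using shorter[of u v] shorter[of v u] eq by force
  with eq show ?thesis by simp
qed

text \<open>Describes the kernel: trivial action at infinity means that every word beyond the
  threshold is fixed, since the tail behind it is arbitrary.\<close>

lemma boundary_map_eq_id_iff: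
  fixes s :: "bool list \<Rightarrow> bool list"
  assumes "s \<in> word_perms"
  shows "boundary_map s = id \<longleftrightarrow> finite {w. s w \<noteq> w}"
proof
  obtain N where N: "tail_preserving_from N s" using assms by (auto simp: word_perms_def)
  assume "boundary_map s = id"
  then have "s u \<frown> x = u \<frown> x" if "N \<le> length u" for u x
    using boundary_map_conc[OF N that, of x] by simp
  then have "s u = u" if "N \<le> length u" for u
    using that conc_eq_imp_eq by blast
  then have "{w. s w \<noteq> w} \<subseteq> {w. length w < N}" by force
  then show "finite {w. s w \<noteq> w}" using finite_short_words finite_subset by blast
next
  assume "finite {w. s w \<noteq> w}"
  then obtain N where N: "\<And>u. u \<in> {w. s w \<noteq> w} \<Longrightarrow> length u < N"
    using finite_word_set_bounded by blast
  then have *: "s u = u" if "N \<le> length u" for u using that by force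
  then have tp: "tail_preserving_from N s" by (simp add: tail_preserving_from_def)
  show "boundary_map s = id"
  proof
    fix x :: "bool word"
    obtain u y where "x = u \<frown> y" "length u = N" by (rule word_split)
    then show "boundary_map s x = id x" by (simp add: boundary_map_conc[OF tp] *)
  qed
qed


section \<open>Complete prefix codes\<close>

lemma conc_eq_prefix:
  assumes "u \<frown> x = v \<frown> y" "length u \<le> length v"
  shows "Sublist.prefix u v"
proof -
  have "(u \<frown> x)[0 \<rightarrow> length u] = (v \<frown> y)[0 \<rightarrow> length u]"
    using assms(1) by simp
  then have "u = take (length u) v"
    using assms(2) by simp
  then show ?thesis by (metis take_is_prefix)
qed

text \<open>Continue \<open>v\<close> by any infinite tail, here constantly \<open>True\<close>; the
  codeword that starts the result is too short to reach into the tail.\<close>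

lemma complete_prefix_codeD_prefix:
  assumes "complete_prefix_code U" "\<And>u. u \<in> U \<Longrightarrow> length u \<le> length v"
  obtains u w where "u \<in> U" "v = u @ w"
proof -
  obtain u y where "u \<in> U" "v \<frown> (\<lambda>_. True) = u \<frown> y"
    using assms(1) unfolding complete_prefix_code_def by blast
  then show thesis using assms(2)[of u] conc_eq_prefix[of u y v "\<lambda>_. True"] that
    by (auto simp: prefix_def)
qed

text \<open>For a complete prefix code these are the proper prefixes of codewords, that is, the
  inner nodes of the finite binary tree with leaf set \<open>U\<close>. In this form the complement
  is visibly the union of the cones over \<open>U\<close>.\<close>

definition inner_nodes :: "'a list set \<Rightarrow> 'a list set" where
  "inner_nodes U = {w. \<forall>u\<in>U. \<not> Sublist.prefix u w}"

lemma finite_inner_nodes: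
  assumes "complete_prefix_code U" shows "finite (inner_nodes U)"
proof -
  have "finite U" using assms by (simp add: complete_prefix_code_def)
  then obtain N where N: "\<And>u. u \<in> U \<Longrightarrow> length u < N" using finite_word_set_bounded by blast
  have "length w < N" if "w \<in> inner_nodes U" for w
  proof (rule ccontr)
    assume "\<not> length w < N"
    then have "\<And>u. u \<in> U \<Longrightarrow> length u \<le> length w" using N by force
    then obtain u w' where "u \<in> U" "w = u @ w'"
      using complete_prefix_codeD_prefix[OF assms] by blast
    then show False using that by (auto simp: inner_nodes_def)
  qed
  then have "inner_nodes U \<subseteq> {w. length w < N}" by auto
  then show ?thesis using finite_short_words finite_subset by blast
qed

text \<open>Counting the children of all inner nodes: every node except the root is a child of one.\<close>

lemma card_complete_prefix_code:
  assumes "complete_prefix_code U" shows "card U = Suc (card (inner_nodes U))"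
proof -
  let ?I = "inner_nodes U"
  have fin: "finite U" "finite ?I"
    using assms finite_inner_nodes by (auto simp: complete_prefix_code_def)
  have free: "u = v" if "u \<in> U" "v \<in> U" "Sublist.prefix u v" for u v
    using assms that by (auto simp: complete_prefix_code_def)
  have disj: "U \<inter> ?I = {}" by (auto simp: inner_nodes_def)
  have root: "[] \<in> U \<union> ?I" by (auto simp: inner_nodes_def)
  have children: "w @ [b] \<in> U \<union> ?I \<longleftrightarrow> w \<in> ?I" for w b
  proof
    assume w: "w \<in> ?I"
    show "w @ [b] \<in> U \<union> ?I"
    proof (rule ccontr)
      assume "w @ [b] \<notin> U \<union> ?I"
      then obtain u where "u \<in> U" "Sublist.prefix u (w @ [b])" "u \<noteq> w @ [b]"
        by (auto simp: inner_nodes_def)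
      with w show False by (auto simp: inner_nodes_def prefix_snoc)
    qed
  next
    assume wb: "w @ [b] \<in> U \<union> ?I"
    show "w \<in> ?I"
    proof (rule ccontr)
      assume "w \<notin> ?I"
      then obtain u where u: "u \<in> U" "Sublist.prefix u w" by (auto simp: inner_nodes_def)
      then have "Sublist.prefix u (w @ [b])" by simp
      with wb u have "u = w @ [b]" using free by (auto simp: inner_nodes_def)
      with u show False by (auto dest: prefix_length_le)
    qed
  qed
  have "U \<union> ?I = insert [] ((\<lambda>(w, b). w @ [b]) ` (?I \<times> UNIV))" (is "_ = insert [] ?C")
  proof (rule Set.set_eqI)
    fix v show "v \<in> U \<union> ?I \<longleftrightarrow> v \<in> insert [] ?C"
    proof (cases v rule: rev_cases)
      case Nil
      with root show ?thesis by simp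
    next
      case (snoc w b)
      then have "v \<in> insert [] ?C \<longleftrightarrow> w \<in> ?I" by (auto simp: image_iff)
      with snoc show ?thesis using children by metis
    qed
  qed
  moreover have "[] \<notin> ?C" by auto
  moreover have "card ?C = card ?I * 2"
    by (subst card_image) (auto simp: inj_on_def card_cartesian_product)
  moreover have "card (U \<union> ?I) = card U + card ?I"
    using fin disj by (intro card_Un_disjoint)
  ultimately show ?thesis using fin by simp
qed

text \<open>Working form of the elements of V: the domain code consists of all blocks of one length,
  which matches the threshold of a tail-preserving map. For bijections it is equivalent to
  \<open>prefix_replacement\<close>.\<close>

definition locally_prefix_replacing :: "(bool word \<Rightarrow> bool word) \<Rightarrow> bool" where
  "locally_prefix_replacing f \<longleftrightarrow> (\<exists>N. \<forall>u. length u = N \<longrightarrow> (\<exists>v. \<forall>x. f (u \<frown> x) = v \<frown> x))"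

lemma complete_prefix_code_length: "complete_prefix_code {u. length u = N}"
proof -
  have "finite {u :: bool list. length u = N}"
    by (rule finite_subset[OF _ finite_short_words[of "Suc N"]]) auto
  moreover have "\<exists>u\<in>{u. length u = N}. \<exists>w. x = u \<frown> w" for x :: "bool word"
    using word_split[of x N] by blast
  ultimately show ?thesis
    by (auto simp: complete_prefix_code_def prefix_def)
qed

text \<open>If \<open>v u\<close> is a prefix of \<open>v u'\<close>, some infinite word starting
  with \<open>u\<close> and some one starting with \<open>u'\<close> have the same image;
  injectivity of \<open>f\<close> and equal block lengths give \<open>u = u'\<close>. Surjectivity
  of \<open>f\<close> gives completeness.\<close>

lemma complete_prefix_code_image:
  fixes f :: "bool word \<Rightarrow> bool word"
  assumes f: "bij f" and v: "\<And>u x. length u = N \<Longrightarrow> f (u \<frown> x) = v u \<frown> x"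
  shows "complete_prefix_code (v ` {u. length u = N})" "inj_on v {u. length u = N}"
proof -
  have *: "u = u'" if "length u = N" "length u' = N" and pre: "Sublist.prefix (v u) (v u')" for u u'
  proof -
    obtain w where "v u' = v u @ w" using pre by (auto simp: prefix_def)
    then have "f (u' \<frown> (\<lambda>_. True)) = v u \<frown> w \<frown> (\<lambda>_. True)"
      using v[OF that(2)] by simp
    also have "\<dots> = f (u \<frown> w \<frown> (\<lambda>_. True))" by (rule v[OF that(1), symmetric])
    finally have "u' \<frown> (\<lambda>_. True) = u \<frown> w \<frown> (\<lambda>_. True)"
      using f by (meson bij_is_inj injD)
    then show ?thesis using that concat_eq by metis
  qed
  then show "inj_on v {u. length u = N}" by (auto intro!: inj_onI)
  have "\<exists>u\<in>v ` {u. length u = N}. \<exists>w. x = u \<frown> w" for x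
  proof -
    obtain y where y: "x = f y" using f by (metis bij_pointE)
    obtain u z where u: "y = u \<frown> z" "length u = N" by (rule word_split)
    then have "x = v u \<frown> z" using v y by simp
    with u(2) show ?thesis by blast
  qed
  moreover have "finite (v ` {u. length u = N})"
    using complete_prefix_code_length by (auto simp: complete_prefix_code_def)
  ultimately show "complete_prefix_code (v ` {u. length u = N})"
    using * by (auto simp: complete_prefix_code_def)
qed

text \<open>A block longer than all codewords begins with one of them; its surplus letters are
  appended to the replacing codeword.\<close>

lemma locally_prefix_replacing_if_prefix_replacement:
  assumes "prefix_replacement f" shows "locally_prefix_replacing f"
proof -
  obtain us vs where U: "length us = length vs" "complete_prefix_code (set us)"
    and f: "\<And>i w. i < length us \<Longrightarrow> f (us ! i \<frown> w) = vs ! i \<frown> w"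
    using assms by (auto simp: prefix_replacement_def)
  obtain N where N: "\<And>u. u \<in> set us \<Longrightarrow> length u < N"
    using finite_word_set_bounded[of "set us"] by blast
  have "\<exists>v. \<forall>x. f (u \<frown> x) = v \<frown> x" if "length u = N" for u
  proof -
    have "\<And>u'. u' \<in> set us \<Longrightarrow> length u' \<le> length u" using N that by force
    then obtain u' w where u': "u' \<in> set us" "u = u' @ w"
      using complete_prefix_codeD_prefix[OF U(2)] by metis
    then obtain i where "i < length us" "u' = us ! i" by (metis in_set_conv_nth)
    then have "f (u \<frown> x) = (vs ! i @ w) \<frown> x" for x
      using f[of i "w \<frown> x"] u' by simp
    then show ?thesis by blast
  qed
  then show ?thesis by (auto simp: locally_prefix_replacing_def)
qed

lemma prefix_replacement_if_locally_prefix_replacing: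
  assumes f: "bij f" and loc: "locally_prefix_replacing f"
  shows "prefix_replacement f"
proof -
  obtain N v where v: "\<And>u x. length u = N \<Longrightarrow> f (u \<frown> x) = v u \<frown> x"
    using loc unfolding locally_prefix_replacing_def by metis
  have "finite {u :: bool list. length u = N}"
    using complete_prefix_code_length by (auto simp: complete_prefix_code_def)
  then obtain us where us: "set us = {u :: bool list. length u = N}" "distinct us"
    using finite_distinct_list by blast
  have "length us = length (map v us)" "distinct (map v us)"
    "complete_prefix_code (set us)" "complete_prefix_code (set (map v us))"
    using complete_prefix_code_image[of f N v, OF f v] us complete_prefix_code_length[of N]
    by (simp_all add: distinct_map)
  moreover have "\<forall>i<length us. \<forall>w. f (us ! i \<frown> w) = map v us ! i \<frown> w"
    using us v nth_mem[of _ us] by auto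
  ultimately show ?thesis unfolding prefix_replacement_def using us(2) by blast
qed

lemma continuous_if_locally_prefix_replacing:
  assumes "locally_prefix_replacing f" shows "continuous_on UNIV f"
proof -
  obtain N v where v: "\<And>u x. length u = N \<Longrightarrow> f (u \<frown> x) = v u \<frown> x"
    using assms unfolding locally_prefix_replacing_def by metis
  \<comment> \<open>Letter \<open>i\<close> of \<open>f x\<close> lies either in the replaced block,
    which depends on the first \<open>N\<close> letters of \<open>x\<close>, or it is copied from a
    position of \<open>x\<close> that is at most \<open>N + i\<close>.\<close>
  have coord: "f y i = f x i" if agree: "\<And>j. j < N + i + 1 \<Longrightarrow> y j = x j" for x y i
  proof -
    let ?u = "x[0 \<rightarrow> N]"
    have u: "y[0 \<rightarrow> N] = ?u" by (rule nth_equalityI) (use agree in auto)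
    have fx: "f x = v ?u \<frown> suffix N x" using v[of ?u "suffix N x"] by simp
    have fy: "f y = v ?u \<frown> suffix N y"
      using v[of "y[0 \<rightarrow> N]" "suffix N y"] unfolding u[symmetric] by simp
    show ?thesis
    proof (cases "i < length (v ?u)")
      case True
      then show ?thesis unfolding fx fy by simp
    next
      case False
      have "y (N + (i - length (v ?u))) = x (N + (i - length (v ?u)))" by (rule agree) simp
      with False show ?thesis unfolding fx fy by simp
    qed
  qed
  have "open ((\<lambda>x. f x i) -` B)" for i and B :: "bool set"
  proof (subst open_subopen, intro ballI)
    fix x assume x: "x \<in> (\<lambda>x. f x i) -` B"
    let ?T = "{y. \<forall>j\<in>{..<N + i + 1}. y j \<in> {x j}}"
    have "open ?T" by (rule product_topology_basis') (simp_all add: open_discrete)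
    moreover have "?T \<subseteq> (\<lambda>x. f x i) -` B" 
    proof
      fix y assume "y \<in> ?T"
      then have "f y i = f x i" by (intro coord) simp
      with x show "y \<in> (\<lambda>x. f x i) -` B" by simp
    qed
    ultimately show "\<exists>T. open T \<and> x \<in> T \<and> T \<subseteq> (\<lambda>x. f x i) -` B" by blast
  qed
  then show ?thesis
    by (intro continuous_on_coordinatewise_then_product) (auto simp: continuous_on_open_vimage)
qed

lemma inner_nodes_length: "inner_nodes {u :: bool list. length u = N} = {w. length w < N}"
proof -
  have "\<exists>u. length u = N \<and> Sublist.prefix u w" if "N \<le> length w" for w :: "bool list"
    using that take_is_prefix[of N w] by (intro exI[of _ "take N w"]) auto
  then show ?thesis by (force simp: inner_nodes_def dest: prefix_length_le)
qed

text \<open>The map on blocks matches the cones over the two codes. What is left over are the inner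
  nodes of two codes of equal size, and they can be matched arbitrarily because finitely many words
  do not influence the boundary.\<close>

lemma boundary_map_onto:
  assumes f: "bij f" and loc: "locally_prefix_replacing f"
  obtains s where "s \<in> word_perms" "boundary_map s = f"
proof -
  obtain K v0 where v0: "\<And>u x. length u = K \<Longrightarrow> f (u \<frown> x) = v0 u \<frown> x"
    using loc unfolding locally_prefix_replacing_def by metis
  \<comment> \<open>One extra letter, copied unchanged, makes every \<open>v u\<close> nonempty.
    Hence the empty word is an inner node of both codes and can be kept as a fixed point.\<close>
  define N where "N = Suc K"
  define v where "v u = v0 (take K u) @ drop K u" for u
  have v: "f (u \<frown> x) = v u \<frown> x" if "length u = N" for u x
    using v0[of "take K u" "drop K u \<frown> x"] that by (simp add: v_def N_def)
  have v_ne: "v u \<noteq> []" if "length u = N" for u using that by (simp add: v_def N_def)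
  let ?U = "{u :: bool list. length u = N}"
  let ?V = "v ` ?U"
  have codeU: "complete_prefix_code ?U" by (rule complete_prefix_code_length)
  note codeV = complete_prefix_code_image[of f N v, OF f v]
  have free: "u = u'" if "Sublist.prefix (v u) (v u')" "length u = N" "length u' = N" for u u'
    using that codeV unfolding complete_prefix_code_def by (auto dest: inj_onD)
  have "card (inner_nodes ?U) = card (inner_nodes ?V)"
    using card_complete_prefix_code[OF codeU] card_complete_prefix_code[OF codeV(1)]
      card_image[OF codeV(2)] by simp
  moreover have root: "[] \<in> inner_nodes ?U" "[] \<in> inner_nodes ?V"
    using v_ne by (auto simp: inner_nodes_def N_def)
  moreover note fin = finite_inner_nodes[OF codeU] finite_inner_nodes[OF codeV(1)]
  ultimately have "card (inner_nodes ?U - {[]}) = card (inner_nodes ?V - {[]})"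
    by simp
  then obtain \<beta> where \<beta>: "bij_betw \<beta> (inner_nodes ?U - {[]}) (inner_nodes ?V - {[]})"
    using fin finite_same_card_bij by (metis finite_Diff)
  define s where "s w = (if N \<le> length w then v (take N w) @ drop N w else if w = [] then [] else \<beta> w)" for w
  \<comment> \<open>The words of length at least \<open>N\<close> form the disjoint cones over the
    blocks, and their images form the disjoint cones over \<open>?V\<close>, which fill the
    complement of its inner nodes.\<close>
  have "bij_betw s {w. N \<le> length w} (- inner_nodes ?V)"
    unfolding bij_betw_def
  proof
    show "inj_on s {w. N \<le> length w}"
    proof (rule inj_onI)
      fix w w' assume w: "w \<in> {w. N \<le> length w}" "w' \<in> {w. N \<le> length w}" and "s w = s w'"
      then have eq: "v (take N w) @ drop N w = v (take N w') @ drop N w'" by (simp add: s_def)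
      then have "Sublist.prefix (v (take N w)) (v (take N w')) \<or> Sublist.prefix (v (take N w')) (v (take N w))"
        by (metis prefixI prefix_same_cases)
      then have "take N w = take N w'" using w free[of "take N w" "take N w'"] free[of "take N w'" "take N w"] by auto
      with eq show "w = w'" by (metis append_take_drop_id same_append_eq)
    qed
    show "s ` {w. N \<le> length w} = - inner_nodes ?V"
    proof (intro equalityI subsetI)
      fix y assume "y \<in> s ` {w. N \<le> length w}"
      then obtain w where "N \<le> length w" "y = v (take N w) @ drop N w" by (auto simp: s_def)
      then show "y \<in> - inner_nodes ?V"
        by (auto simp: inner_nodes_def intro!: exI[of _ "take N w"])
    next
      fix y assume "y \<in> - inner_nodes ?V"
      then obtain u w where u: "length u = N" "y = v u @ w" by (auto simp: inner_nodes_def prefix_def)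
      then show "y \<in> s ` {w. N \<le> length w}"
        by (intro image_eqI[of _ _ "u @ w"]) (auto simp: s_def)
    qed
  qed
  moreover have "bij_betw s (inner_nodes ?U - {[]}) (inner_nodes ?V - {[]})"
    using \<beta> by (rule bij_betw_cong[THEN iffD1, rotated]) (auto simp: s_def inner_nodes_length)
  moreover have "bij_betw s {[]} {[]}" by (simp add: bij_betw_def s_def N_def)
  ultimately have "bij_betw s ({w. N \<le> length w} \<union> (inner_nodes ?U - {[]} \<union> {[]}))
      (- inner_nodes ?V \<union> (inner_nodes ?V - {[]} \<union> {[]}))"
    by (intro bij_betw_combine) (use root in auto)
  moreover have "{w. N \<le> length w} \<union> (inner_nodes ?U - {[]} \<union> {[]}) = UNIV"
    by (auto simp: inner_nodes_length)
  moreover have "- inner_nodes ?V \<union> (inner_nodes ?V - {[]} \<union> {[]}) = UNIV"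
    using root by auto
  ultimately have "bij s" by simp
  moreover have tp: "tail_preserving_from N s"
    by (auto simp: tail_preserving_from_def s_def)
  ultimately have "s \<in> word_perms" by (auto simp: word_perms_def s_def N_def)
  moreover have "boundary_map s = f"
  proof
    fix x :: "bool word"
    obtain u y where x: "x = u \<frown> y" "length u = N" by (rule word_split)
    then show "boundary_map s x = f x"
      by (simp add: boundary_map_conc[OF tp] v s_def)
  qed
  ultimately show thesis by (rule that)
qed

lemma boundary_map_locally_prefix_replacing:
  assumes "s \<in> word_perms" shows "locally_prefix_replacing (boundary_map s)"
proof -
  obtain N where "tail_preserving_from N s" using assms by (auto simp: word_perms_def)
  then show ?thesis
    unfolding locally_prefix_replacing_def by (blast intro: boundary_map_conc[OF _ eq_refl] sym)
qed

text \<open>The inverse of \<open>boundary_map s\<close> is again a boundary map, so local prefix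
  replacement yields continuity in both directions. The description lets the group laws be
  transported from word permutations.\<close>

lemma carrier_Thompson_V: "carrier Thompson_V = boundary_map ` word_perms"
proof (intro equalityI subsetI)
  fix f assume "f \<in> carrier Thompson_V"
  then obtain f' where f': "homeomorphism UNIV UNIV f f'" and "prefix_replacement f"
    by (auto simp: Thompson_V_def)
  moreover have "bij f"
    using f' by (intro o_bij[of f' f]) (auto simp: homeomorphism_def)
  ultimately obtain s where "s \<in> word_perms" "boundary_map s = f"
    using boundary_map_onto locally_prefix_replacing_if_prefix_replacement by blast
  then show "f \<in> boundary_map ` word_perms" by blast
next
  fix f :: "bool word \<Rightarrow> bool word" assume "f \<in> boundary_map ` word_perms"
  then obtain s where s: "s \<in> word_perms" "f = boundary_map s" by blast
  let ?f' = "boundary_map (inv_into UNIV s)"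
  have "f (?f' x) = x" "?f' (f x) = x" for x
    using boundary_map_inv[OF s(1), THEN fun_cong, of x] s(2) by simp_all
  moreover from this have "f ` UNIV = UNIV" "?f' ` UNIV = UNIV"
    by (metis surjI)+
  moreover have "continuous_on UNIV f" "continuous_on UNIV ?f'"
    using s word_perms_inv by (auto intro!: continuous_if_locally_prefix_replacing
        boundary_map_locally_prefix_replacing)
  ultimately have "homeomorphism UNIV UNIV f ?f'" by (auto simp: homeomorphism_def)
  moreover have "prefix_replacement f"
    using s boundary_map_bij boundary_map_locally_prefix_replacing
    by (auto intro: prefix_replacement_if_locally_prefix_replacing)
  ultimately show "f \<in> carrier Thompson_V" by (auto simp: Thompson_V_def)
qed

section \<open>Group laws of V obtained from composition of word permutations\<close>

lemma Bij_UNIV: "f \<in> Bij UNIV \<longleftrightarrow> bij f"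
  by (simp add: Bij_def)

lemma compose_UNIV: "compose UNIV f g = f \<circ> g"
  by (simp add: fun_eq_iff compose_def)

lemma mult_Thompson_V:
  "s \<in> word_perms \<Longrightarrow> t \<in> word_perms \<Longrightarrow>
    boundary_map s \<otimes>\<^bsub>Thompson_V\<^esub> boundary_map t = boundary_map (s \<circ> t)"
  by (simp add: Thompson_V_def BijGroup_def Bij_UNIV compose_UNIV boundary_map_bij
      boundary_map_comp_word_perms)

lemma one_Thompson_V: "\<one>\<^bsub>Thompson_V\<^esub> = id"
  by (simp add: Thompson_V_def BijGroup_def fun_eq_iff)

lemma group_Thompson_V: "group Thompson_V"
proof (rule groupI)
  show "\<one>\<^bsub>Thompson_V\<^esub> \<in> carrier Thompson_V"
    unfolding one_Thompson_V carrier_Thompson_V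
    by (rule image_eqI[where x = id]) (simp_all add: boundary_map_id word_perms_id)
next
  fix x assume "x \<in> carrier Thompson_V"
  then obtain s where s: "s \<in> word_perms" "x = boundary_map s" by (auto simp: carrier_Thompson_V)
  show "\<one>\<^bsub>Thompson_V\<^esub> \<otimes>\<^bsub>Thompson_V\<^esub> x = x"
    using mult_Thompson_V[OF word_perms_id s(1)] s(2) by (simp add: one_Thompson_V boundary_map_id)
  have "boundary_map (inv_into UNIV s) \<otimes>\<^bsub>Thompson_V\<^esub> x = \<one>\<^bsub>Thompson_V\<^esub>"
    using s word_perms_inv[of s] mult_Thompson_V[of "inv_into UNIV s" s]
    by (simp add: one_Thompson_V boundary_map_id word_perms_inv_comp)
  then show "\<exists>y\<in>carrier Thompson_V. y \<otimes>\<^bsub>Thompson_V\<^esub> x = \<one>\<^bsub>Thompson_V\<^esub>"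
    using s word_perms_inv by (auto simp: carrier_Thompson_V)
qed (auto simp: carrier_Thompson_V mult_Thompson_V word_perms_comp comp_assoc)


section \<open>The modular group\<close>

text \<open>Elements of \<open>PSL2Z\<close> are extensional; ignoring values outside the upper
  half-plane allows plain lambda terms and ordinary composition.\<close>

definition modular :: "(complex \<Rightarrow> complex) \<Rightarrow> bool" where
  "modular f \<longleftrightarrow> restrict f upper_half_plane \<in> PSL2Z"

lemma modular_iff:
  "modular f \<longleftrightarrow> (\<exists>a b c d :: int. a * d - b * c = 1 \<and>
     (\<forall>z\<in>upper_half_plane. f z = (of_int a * z + of_int b) / (of_int c * z + of_int d)))"
proof
  assume "modular f"
  then obtain A where A: "restrict f upper_half_plane = restrict (moebius A) upper_half_plane" "det A = 1"
    by (auto simp: modular_def PSL2Z_def)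
  then have "f z = moebius A z" if "z \<in> upper_half_plane" for z
    using that by (metis restrict_apply')
  then show "\<exists>a b c d :: int. a * d - b * c = 1 \<and>
     (\<forall>z\<in>upper_half_plane. f z = (of_int a * z + of_int b) / (of_int c * z + of_int d))"
    using A(2) by (auto simp: moebius_def det_2)
next
  assume "\<exists>a b c d :: int. a * d - b * c = 1 \<and>
     (\<forall>z\<in>upper_half_plane. f z = (of_int a * z + of_int b) / (of_int c * z + of_int d))"
  then obtain a b c d :: int where det1: "a * d - b * c = 1"
    and f: "\<And>z. z \<in> upper_half_plane \<Longrightarrow> f z = (of_int a * z + of_int b) / (of_int c * z + of_int d)"
    by auto
  define A :: "int^2^2" where "A = vector [vector [a, b], vector [c, d]]"
  have "restrict f upper_half_plane = restrict (moebius A) upper_half_plane"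
    by (rule restrict_ext) (simp add: f moebius_def A_def)
  moreover have "det A = 1" using det1 by (simp add: det_2 A_def)
  ultimately show "modular f" by (auto simp: modular_def PSL2Z_def)
qed

lemma modularI:
  fixes a b c d :: int
  assumes "a * d - b * c = 1"
    "\<And>z. z \<in> upper_half_plane \<Longrightarrow> f z = (of_int a * z + of_int b) / (of_int c * z + of_int d)"
  shows "modular f"
  using assms unfolding modular_iff by blast

lemma modular_PSL2Z: "\<gamma> \<in> PSL2Z \<Longrightarrow> modular \<gamma>"
  by (auto simp: modular_def PSL2Z_def)

lemma modular_denominator_nonzero:
  fixes a b c d :: int
  assumes "z \<in> upper_half_plane" "a * d - b * c = 1"
  shows "of_int c * z + of_int d \<noteq> 0"
proof
  assume *: "of_int c * z + of_int d = 0"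
  then have "Im (of_int c * z + of_int d) = 0" "Re (of_int c * z + of_int d) = 0" by simp_all
  with assms show False by (auto simp: upper_half_plane_def)
qed

lemma modular_mem:
  assumes "modular f" and z: "z \<in> upper_half_plane" shows "f z \<in> upper_half_plane"
proof -
  obtain a b c d :: int where det1: "a * d - b * c = 1"
    and f: "f z = (of_int a * z + of_int b) / (of_int c * z + of_int d)"
    using assms by (auto simp: modular_iff)
  let ?w = "of_int c * z + of_int d"
  have "?w \<noteq> 0" using modular_denominator_nonzero[OF z det1] .
  then have pos: "(Re ?w)\<^sup>2 + (Im ?w)\<^sup>2 > 0" by (simp add: complex_neq_0)
  have "Im (f z) = real_of_int (a * d - b * c) * Im z / ((Re ?w)\<^sup>2 + (Im ?w)\<^sup>2)"
    unfolding f Im_divide by (simp add: algebra_simps)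
  then show ?thesis using det1 pos z by (simp add: upper_half_plane_def)
qed

lemma modular_comp:
  assumes "modular f" "modular g" shows "modular (f \<circ> g)"
proof -
  obtain a b c d :: int where det1: "a * d - b * c = 1"
    and f: "\<And>z. z \<in> upper_half_plane \<Longrightarrow> f z = (of_int a * z + of_int b) / (of_int c * z + of_int d)"
    using assms(1) by (auto simp: modular_iff)
  obtain a' b' c' d' :: int where det1': "a' * d' - b' * c' = 1"
    and g: "\<And>z. z \<in> upper_half_plane \<Longrightarrow> g z = (of_int a' * z + of_int b') / (of_int c' * z + of_int d')"
    using assms(2) by (auto simp: modular_iff)
  show ?thesis
  proof (rule modularI)
    have "(a * a' + b * c') * (c * b' + d * d') - (a * b' + b * d') * (c * a' + d * c')
        = (a * d - b * c) * (a' * d' - b' * c')" by algebra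
    then show "(a * a' + b * c') * (c * b' + d * d') - (a * b' + b * d') * (c * a' + d * c') = 1"
      by (simp add: det1 det1')
    fix z assume z: "z \<in> upper_half_plane"
    have w: "of_int c' * z + of_int d' \<noteq> 0" using modular_denominator_nonzero[OF z det1'] .
    have "(f \<circ> g) z = (of_int a * g z + of_int b) / (of_int c * g z + of_int d)"
      using f modular_mem[OF assms(2) z] by simp
    also have "\<dots> = (of_int a * (of_int a' * z + of_int b') + of_int b * (of_int c' * z + of_int d')) /
        (of_int c * (of_int a' * z + of_int b') + of_int d * (of_int c' * z + of_int d'))"
      unfolding g[OF z] using w by (simp add: add_frac_eq add_divide_eq_iff divide_add_eq_iff)
    finally show "(f \<circ> g) z = (of_int (a * a' + b * c') * z + of_int (a * b' + b * d')) /
        (of_int (c * a' + d * c') * z + of_int (c * b' + d * d'))"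
      by (simp add: algebra_simps)
  qed
qed

lemma modular_inv:
  assumes "modular f"
  obtains g where "modular g" "\<And>z. z \<in> upper_half_plane \<Longrightarrow> g (f z) = z"
    "\<And>z. z \<in> upper_half_plane \<Longrightarrow> f (g z) = z"
proof -
  \<comment> \<open>Inversion by the adjugate matrix, stated for arbitrary entries so that it
    applies to \<open>f\<close> and, with the adjugate entries, to \<open>g\<close> as well.\<close>
  have inverse: "(of_int d * w - of_int b) / (- of_int c * w + of_int a) = z"
    if "a * d - b * c = 1" "z \<in> upper_half_plane"
      "w = (of_int a * z + of_int b) / (of_int c * z + of_int d)" for a b c d :: int and w z :: complex
  proof -
    have nz: "of_int c * z + of_int d \<noteq> 0" using modular_denominator_nonzero that by blast
    have det1: "of_int a * of_int d - of_int b * of_int c = (1 :: complex)"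
      using arg_cong[OF that(1), of of_int] by simp
    have w: "w * (of_int c * z + of_int d) = of_int a * z + of_int b" using that nz by simp
    have "(- of_int c * w + of_int a) * (of_int c * z + of_int d)
        = of_int a * of_int d - of_int b * of_int c"
      using w by algebra
    then have "- of_int c * w + of_int a \<noteq> 0" using det1 by auto
    moreover have "of_int d * w - of_int b = z * (- of_int c * w + of_int a)"
      using w by (simp add: algebra_simps)
    ultimately show ?thesis by simp
  qed
  obtain a b c d :: int where det1: "a * d - b * c = 1"
    and f: "\<And>z. z \<in> upper_half_plane \<Longrightarrow> f z = (of_int a * z + of_int b) / (of_int c * z + of_int d)"
    using assms by (auto simp: modular_iff)
  define g where "g z = (of_int d * z - of_int b) / (- of_int c * z + of_int a)" for z :: complex
  have "modular g"
    by (rule modularI[of d a "- b" "- c"]) (use det1 in \<open>simp_all add: g_def algebra_simps\<close>)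
  moreover have "g (f z) = z" if "z \<in> upper_half_plane" for z
    unfolding g_def using inverse[OF det1 that f[OF that]] .
  moreover have "f (g z) = z" if z: "z \<in> upper_half_plane" for z
    using inverse[of d a "- b" "- c" z "g z"] det1 z f[OF modular_mem[OF \<open>modular g\<close> z]]
    by (simp add: g_def algebra_simps)
  ultimately show thesis by (rule that)
qed

lemma modular_id: "modular id"
  by (rule modularI[of 1 1 0 0]) auto

lemma modular_shift: "modular (\<lambda>z. z + 1)"
  by (rule modularI[of 1 1 1 0]) auto

lemma modular_S: "modular (\<lambda>z. - 1 / z)"
  by (rule modularI[of 0 0 "- 1" 1]) auto

lemma modular_L: "modular (\<lambda>z. z / (z + 1))"
  by (rule modularI[of 1 1 0 1]) auto

text \<open>The Euclidean algorithm on the first column of the matrix.\<close>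

lemma modular_induct [consumes 1, case_names id S plus minus]:
  assumes "modular f"
    and id: "\<And>f. (\<And>z. z \<in> upper_half_plane \<Longrightarrow> f z = z) \<Longrightarrow> Q f"
    and S: "\<And>f g. Q g \<Longrightarrow> (\<And>z. z \<in> upper_half_plane \<Longrightarrow> f z = - 1 / g z) \<Longrightarrow> Q f"
    and plus: "\<And>f g. Q g \<Longrightarrow> (\<And>z. z \<in> upper_half_plane \<Longrightarrow> f z = g z + 1) \<Longrightarrow> Q f"
    and minus: "\<And>f g. Q g \<Longrightarrow> (\<And>z. z \<in> upper_half_plane \<Longrightarrow> f z = g z - 1) \<Longrightarrow> Q f"
  shows "Q f"
proof -
  have shift: "Q f" if "Q g" "\<And>z. z \<in> upper_half_plane \<Longrightarrow> f z = g z + of_int k"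
    for f g and k :: int
  proof -
    have "Q (\<lambda>z. g z + of_int k)"
    proof (induction k rule: int_induct[of _ 0])
      case base
      have "Q (\<lambda>z. (g z + 1) - 1)" by (rule minus[OF plus[OF \<open>Q g\<close>]]) auto
      then show ?case by simp
    next
      case (step1 i)
      show ?case by (rule plus[OF step1(2)]) simp
    next
      case (step2 i)
      show ?case by (rule minus[OF step2(2)]) simp
    qed
    \<comment> \<open>The lambda term and \<open>f\<close> agree only on the upper half-plane, and
      the rules permit such a change only together with a step; adding and subtracting 1 provides
      one.\<close>
    from minus[OF plus[OF this], of "\<lambda>z. g z + of_int k + 1" f] that(2) show "Q f" by simp
  qed
  obtain a b c d :: int where "a * d - b * c = 1"
    "\<And>z. z \<in> upper_half_plane \<Longrightarrow> f z = (of_int a * z + of_int b) / (of_int c * z + of_int d)"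
    using assms(1) by (auto simp: modular_iff)
  then show ?thesis
  proof (induction "nat \<bar>c\<bar>" arbitrary: a b c d f rule: less_induct)
    case less
    note det1 = less.prems(1) and f = less.prems(2)
    show ?case
    proof (cases "c = 0")
      case True
      with det1 have "a = 1 \<and> d = 1 \<or> a = - 1 \<and> d = - 1"
        using zmult_eq_1_iff by auto
      \<comment> \<open>The translation is by \<open>b / d\<close>, which is \<open>a * b\<close>
        for both signs of \<open>a = d\<close>.\<close>
      then have "f z = id z + of_int (a * b)" if "z \<in> upper_half_plane" for z
        using f[OF that] True by auto
      then show ?thesis by (rule shift[rotated]) (simp_all add: id)
    next
      case False
      define k where "k = a div c"
      define r where "r = a mod c"
      have a: "a = k * c + r" by (simp add: k_def r_def)
      \<comment> \<open>Obtained by solving \<open>f z = - 1 / h z + of_int k\<close> for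
        \<open>h\<close>: subtracting the quotient \<open>k\<close> leaves the remainder
        \<open>r\<close> above \<open>c\<close>, and the inversion moves \<open>r\<close> to the
        lower left entry, the induction measure.\<close>
      define h where "h z = (of_int (- c) * z + of_int (- d)) / (of_int r * z + of_int (b - k * d))" for z :: complex
      have "nat \<bar>r\<bar> < nat \<bar>c\<bar>" using False abs_mod_less[of c a] by (simp add: r_def)
      moreover have det1': "(- c) * (b - k * d) - (- d) * r = 1" using det1 a by (simp add: algebra_simps)
      ultimately have "Q h" by (rule less.hyps) (simp add: h_def)
      then have "Q (\<lambda>z. - 1 / h z)" by (rule S) simp
      moreover have "f z = - 1 / h z + of_int k" if z: "z \<in> upper_half_plane" for z
      proof -
        have nz: "of_int c * z + of_int d \<noteq> 0" using modular_denominator_nonzero[OF z det1] .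
        have "h z = - ((of_int c * z + of_int d) / (of_int r * z + of_int (b - k * d)))"
          unfolding h_def minus_divide_left by simp
        moreover have "- 1 / - (p / q) = q / p" for p q :: complex by simp
        ultimately have "- 1 / h z = (of_int r * z + of_int (b - k * d)) / (of_int c * z + of_int d)"
          by (simp only:)
        moreover have "of_int r = of_int a - of_int k * (of_int c :: complex)"
          using a by simp
        ultimately show ?thesis unfolding f[OF z] using nz
          by (simp add: add_divide_eq_iff divide_add_eq_iff) (simp add: algebra_simps)
      qed
      ultimately show ?thesis by (rule shift)
    qed
  qed
qed


section \<open>The orbit as the vertex set of a binary tree\<close>

definition rho :: complex where "rho = exp (\<i> * of_real (pi / 3))"

lemma rho_eq: "rho = Complex (1 / 2) (sqrt 3 / 2)"
  by (simp add: rho_def complex_eq_iff Re_exp Im_exp cos_60 sin_60)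

text \<open>\<open>rho\<close> is a primitive sixth root of unity. In the form
  \<open>rho - 1 = - 1 / rho\<close> this says that translation by -1 takes \<open>rho\<close>
  across the removed edge.\<close>

lemma rho_square: "rho * rho = rho - 1"
  by (simp add: rho_eq complex_eq_iff)

lemma norm_rho: "cmod rho = 1"
  by (simp add: rho_def)

lemma rho_neq_0: "rho \<noteq> 0"
  using norm_rho by force

text \<open>The words over z + 1 (letter True) and z / (z + 1) (letter False) enumerate the vertices of the
  component with positive real part that is left when the edge through i is removed from the
  tree spanned by Omega; the involution -1 / z exchanges the two components.\<close>

primrec half_tree :: "bool list \<Rightarrow> complex" where
  "half_tree [] = rho"
| "half_tree (b # w) = (if b then half_tree w + 1 else half_tree w / (half_tree w + 1))"

text \<open>The first letter selects the component. The value 0 at \<open>[]\<close> is a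
  placeholder outside the upper half-plane.\<close>

primrec vertex :: "bool list \<Rightarrow> complex" where
  "vertex [] = 0"
| "vertex (b # w) = (if b then half_tree w else - 1 / half_tree w)"

lemma half_tree_upper: "half_tree w \<in> upper_half_plane"
proof (induction w)
  case Nil
  show ?case by (simp add: rho_eq upper_half_plane_def)
next
  case (Cons b w)
  then show ?case using modular_mem[OF modular_shift] modular_mem[OF modular_L] by auto
qed

lemma Re_half_tree: "Re (half_tree w) > 0"
proof (induction w)
  case Nil
  show ?case by (simp add: rho_eq)
next
  case (Cons b w)
  let ?z = "half_tree w"
  have "Re (?z / (?z + 1)) > 0"
    unfolding Re_divide using Cons by (intro divide_pos_pos) (auto intro!: add_pos_nonneg)
  with Cons show ?case by auto
qed

lemma half_tree_neq_0: "half_tree w \<noteq> 0" "half_tree w + 1 \<noteq> 0"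
  using Re_half_tree[of w] by (auto simp: complex_eq_iff)

text \<open>As real parts are positive, z + 1 lands outside the unit circle and z / (z + 1) inside,
  while \<open>rho\<close> lies on it. This ping-pong recovers the first letter of a word and later
  decides \<open>half_plane\<close> on cones.\<close>

lemma norm_half_tree_True: "cmod (half_tree (True # w)) > 1"
  using Re_half_tree[of w] abs_Re_le_cmod[of "half_tree w + 1"] by simp

lemma norm_half_tree_False: "cmod (half_tree (False # w)) < 1"
proof -
  let ?z = "half_tree w"
  have "(cmod ?z)\<^sup>2 < (cmod (?z + 1))\<^sup>2"
    using Re_half_tree[of w] unfolding cmod_power2 by (simp add: power2_eq_square algebra_simps)
  then have "cmod ?z < cmod (?z + 1)" using power2_less_imp_less norm_ge_zero by blast
  then show ?thesis using half_tree_neq_0[of w] by (simp add: norm_divide)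
qed

lemma inj_half_tree: "inj half_tree"
proof
  show "u = v" if "half_tree u = half_tree v" for u v
    using that
  proof (induction u arbitrary: v)
    case Nil
    then show ?case
      using norm_half_tree_True[of "tl v"] norm_half_tree_False[of "tl v"] norm_rho
      by (cases v; cases "hd v") (auto simp del: half_tree.simps(2))
  next
    case (Cons b u)
    note norms = norm_half_tree_True[of u] norm_half_tree_False[of u]
      norm_half_tree_True[of "tl v"] norm_half_tree_False[of "tl v"]
    have nz: "half_tree w + 1 \<noteq> 0" for w using half_tree_neq_0 by blast
    obtain c v' where v: "v = c # v'"
      using Cons.prems norms norm_rho by (cases v; cases b) (auto simp del: half_tree.simps(2))
    have "b = c"
      using Cons.prems norms v by (cases b; cases c) (auto simp del: half_tree.simps(2))
    moreover have "half_tree u = half_tree v'"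
      using Cons.prems nz[of u] nz[of v'] unfolding v \<open>b = c\<close>
      by (cases c) (auto simp: divide_eq_eq eq_divide_eq algebra_simps)
    ultimately show ?case using Cons.IH v by blast
  qed
qed

lemma vertex_upper: "w \<noteq> [] \<Longrightarrow> vertex w \<in> upper_half_plane"
  using half_tree_upper modular_mem[OF modular_S] by (cases w) auto

lemma Re_vertex_True: "Re (vertex (True # w)) > 0"
  by (simp add: Re_half_tree)

lemma Re_vertex_False: "Re (vertex (False # w)) < 0"
  using Re_half_tree[of w] half_tree_neq_0[of w]
  by (simp add: Re_divide complex_neq_0 divide_neg_pos)

lemma inj_on_vertex: "inj_on vertex {w. w \<noteq> []}"
proof (rule inj_onI)
  fix u v assume "u \<in> {w. w \<noteq> []}" "v \<in> {w. w \<noteq> []}" and eq: "vertex u = vertex v"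
  then obtain b u' c v' where uv: "u = b # u'" "v = c # v'" by (metis list.exhaust mem_Collect_eq)
  have "b = c"
    using eq Re_vertex_True[of u'] Re_vertex_True[of v'] Re_vertex_False[of u'] Re_vertex_False[of v']
    unfolding uv by (cases b; cases c) auto
  then have "half_tree u' = half_tree v'"
    using eq half_tree_neq_0 unfolding uv by (cases c) (auto simp: field_simps)
  then show "u = v" using inj_half_tree \<open>b = c\<close> uv by (simp add: inj_eq)
qed

text \<open>The letters of \<open>u\<close> are the outer maps, so their composite does not depend
  on the continuation \<open>w\<close>: the cone at \<open>u\<close> is a modular image of the
  entire half tree.\<close>

lemma half_tree_append: "\<exists>f. modular f \<and> (\<forall>w. half_tree (u @ w) = f (half_tree w))"
proof (induction u)
  case Nil
  show ?case using modular_id by (intro exI[of _ id]) (simp del: id_apply, simp)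
next
  case (Cons b u)
  then obtain f where f: "modular f" "\<And>w. half_tree (u @ w) = f (half_tree w)" by auto
  show ?case
  proof (cases b)
    case True
    then show ?thesis using f(2)
      by (intro exI[of _ "(\<lambda>z. z + 1) \<circ> f"] conjI modular_comp[OF modular_shift f(1)]) simp
  next
    case False
    then show ?thesis using f(2)
      by (intro exI[of _ "(\<lambda>z. z / (z + 1)) \<circ> f"] conjI modular_comp[OF modular_L f(1)]) simp
  qed
qed

lemma vertex_append:
  assumes "u \<noteq> []"
  obtains f where "modular f" "\<And>w. vertex (u @ w) = f (half_tree w)"
proof -
  obtain b u' where u: "u = b # u'" using assms by (cases u) auto
  obtain f where f: "modular f" "\<And>w. half_tree (u' @ w) = f (half_tree w)"
    using half_tree_append by blast
  show thesis
  proof (cases b)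
    case True
    then show thesis using f u by (intro that[of f]) auto
  next
    case False
    then show thesis using f u modular_comp[OF modular_S f(1)]
      by (intro that[of "(\<lambda>z. - 1 / z) \<circ> f"]) auto
  qed
qed

definition acts_on_words :: "(complex \<Rightarrow> complex) \<Rightarrow> bool" where
  "acts_on_words f \<longleftrightarrow> (\<exists>s N. tail_preserving_from N s \<and>
     (\<forall>w. w \<noteq> [] \<longrightarrow> s w \<noteq> [] \<and> f (vertex w) = vertex (s w)))"

lemma acts_on_wordsI:
  assumes "tail_preserving_from N s" "\<And>w. w \<noteq> [] \<Longrightarrow> s w \<noteq> [] \<and> f (vertex w) = vertex (s w)"
  shows "acts_on_words f"
  using assms unfolding acts_on_words_def by blast

text \<open>Has the shape of the induction steps of \<open>modular_induct\<close>, with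
  \<open>h\<close> one of the three generating moves.\<close>

lemma acts_on_words_comp:
  assumes "acts_on_words h" "acts_on_words g" "\<And>z. z \<in> upper_half_plane \<Longrightarrow> f z = h (g z)"
  shows "acts_on_words f"
proof -
  obtain s N t M where s: "tail_preserving_from N s"
      "\<And>w. w \<noteq> [] \<Longrightarrow> s w \<noteq> [] \<and> h (vertex w) = vertex (s w)"
    and t: "tail_preserving_from M t"
      "\<And>w. w \<noteq> [] \<Longrightarrow> t w \<noteq> [] \<and> g (vertex w) = vertex (t w)"
    using assms(1,2) unfolding acts_on_words_def by blast
  show ?thesis
    using s(2) t(2) assms(3) vertex_upper
    by (intro acts_on_wordsI[OF tail_preserving_from_comp[OF s(1) t(1)]]) simp
qed

lemma acts_on_words_S: "acts_on_words (\<lambda>z. - 1 / z)"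
proof (rule acts_on_wordsI)
  let ?t = "\<lambda>w. case w of [] \<Rightarrow> [] | b # w \<Rightarrow> (\<not> b) # w"
  show "tail_preserving_from 1 ?t"
    by (auto simp: tail_preserving_from_def split: list.splits)
  show "?t w \<noteq> [] \<and> - 1 / vertex w = vertex (?t w)" if "w \<noteq> []" for w
    using that half_tree_neq_0 by (cases w) auto
qed

text \<open>The clauses come from rho - 1 + 1 = rho, -1 / (z + 1) + 1 = z / (z + 1) and -(z + 1) / z
  + 1 = -1 / z. At most two letters are inspected, hence the threshold 2.\<close>

lemma acts_on_words_plus: "acts_on_words (\<lambda>z. z + 1)"
proof (rule acts_on_wordsI)
  let ?t = "\<lambda>w. case w of [] \<Rightarrow> [] | b # v \<Rightarrow> if b then True # w else
    (case v of [] \<Rightarrow> [True] | c # v' \<Rightarrow> if c then True # False # v' else v)"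
  show "tail_preserving_from 2 ?t"
    by (auto simp: tail_preserving_from_def split: list.splits)
  show "?t w \<noteq> [] \<and> vertex w + 1 = vertex (?t w)" if "w \<noteq> []" for w
    using that half_tree_neq_0 rho_neq_0 rho_square
    by (auto split: list.splits simp: field_simps)
qed

text \<open>The word map is the inverse of the one used for z + 1.\<close>

lemma acts_on_words_minus: "acts_on_words (\<lambda>z. z - 1)"
proof (rule acts_on_wordsI)
  let ?t = "\<lambda>w. case w of [] \<Rightarrow> [] | b # v \<Rightarrow> if \<not> b then False # w else
    (case v of [] \<Rightarrow> [False] | c # v' \<Rightarrow> if c then v else False # True # v')"
  show "tail_preserving_from 2 ?t"
    by (auto simp: tail_preserving_from_def split: list.splits)
  show "?t w \<noteq> [] \<and> vertex w - 1 = vertex (?t w)" if "w \<noteq> []" for w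
    using that half_tree_neq_0 rho_neq_0 rho_square
    by (auto split: list.splits simp: field_simps)
qed

lemma modular_acts_on_words: "modular f \<Longrightarrow> acts_on_words f"
proof (induction rule: modular_induct)
  case (id f)
  then show ?case using vertex_upper
    by (intro acts_on_wordsI[of 0 id]) (auto simp: tail_preserving_from_def)
qed (blast intro: acts_on_words_comp acts_on_words_S acts_on_words_plus acts_on_words_minus)+

lemma Omega_eq: "Omega = {f rho | f. modular f}"
proof -
  have "rho \<in> upper_half_plane" using half_tree_upper[of "[]"] by simp
  then show ?thesis
    unfolding Omega_def rho_def[symmetric]
    by (auto intro!: modular_PSL2Z) (metis modular_def restrict_apply')
qed

text \<open>Since \<open>rho\<close> is \<open>vertex [True]\<close>, one inclusion holds because
  modular maps send vertices to vertices, the other because each vertex is a modular image of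
  \<open>rho\<close>.\<close>

lemma Omega_vertex: "Omega = vertex ` {w. w \<noteq> []}"
proof (intro equalityI subsetI)
  fix z assume "z \<in> Omega"
  then obtain f where "modular f" "z = f (vertex [True])" by (auto simp: Omega_eq)
  then show "z \<in> vertex ` {w. w \<noteq> []}" using modular_acts_on_words unfolding acts_on_words_def by blast
next
  fix z assume "z \<in> vertex ` {w. w \<noteq> []}"
  then obtain u where "u \<noteq> []" "z = vertex (u @ [])" by auto
  then show "z \<in> Omega" by (metis (mono_tags, lifting) Omega_eq half_tree.simps(1) mem_Collect_eq vertex_append)
qed

lemma Omega_upper: "z \<in> Omega \<Longrightarrow> z \<in> upper_half_plane"
  using vertex_upper by (auto simp: Omega_vertex)

lemma modular_Omega:
  assumes "modular f" "z \<in> Omega" shows "f z \<in> Omega"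
  using modular_acts_on_words[OF assms(1)] assms(2) by (auto simp: Omega_vertex acts_on_words_def)


section \<open>Polyhedral pieces of the orbit\<close>

definition cone_decided :: "complex set \<Rightarrow> bool" where
  "cone_decided K \<longleftrightarrow> (\<exists>N. \<forall>u. N \<le> length u \<longrightarrow>
     (\<forall>w. vertex (u @ w) \<in> K) \<or> (\<forall>w. vertex (u @ w) \<notin> K))"

lemma cone_decided_vimage:
  assumes f: "modular f" and K: "cone_decided K"
    and K': "\<And>z. z \<in> upper_half_plane \<Longrightarrow> z \<in> K' \<longleftrightarrow> f z \<in> K"
  shows "cone_decided K'"
proof -
  obtain s N where s: "tail_preserving_from N s"
    "\<And>w. w \<noteq> [] \<Longrightarrow> s w \<noteq> [] \<and> f (vertex w) = vertex (s w)"
    using modular_acts_on_words[OF f] unfolding acts_on_words_def by blast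
  obtain M where M: "\<And>u. M \<le> length u \<Longrightarrow>
     (\<forall>w. vertex (u @ w) \<in> K) \<or> (\<forall>w. vertex (u @ w) \<notin> K)"
    using K unfolding cone_decided_def by blast
  \<comment> \<open>\<open>s\<close> shortens words by at most \<open>N\<close>, so
    \<open>s u\<close> still has length at least \<open>M\<close>; the \<open>Suc\<close> excludes
    the empty word.\<close>
  have "(\<forall>w. vertex (u @ w) \<in> K') \<or> (\<forall>w. vertex (u @ w) \<notin> K')" if "Suc (N + M) \<le> length u" for u
  proof -
    have "M \<le> length (s u)" using tail_preserving_from_length[OF s(1), of u] that by simp
    moreover have "vertex (u @ w) \<in> K' \<longleftrightarrow> vertex (s u @ w) \<in> K" for w
    proof -
      have "u @ w \<noteq> []" using that by auto
      then have "vertex (u @ w) \<in> K' \<longleftrightarrow> vertex (s (u @ w)) \<in> K"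
        using s(2) K' vertex_upper by metis
      also have "s (u @ w) = s u @ w" using s(1) that by (simp add: tail_preserving_fromD)
      finally show ?thesis .
    qed
    ultimately show ?thesis using M[of "s u"] by simp
  qed
  then show ?thesis unfolding cone_decided_def by blast
qed

text \<open>The second letter tells on which side of the unit circle the half-tree point lies, and a
  first letter \<open>False\<close> exchanges the sides. Two letters therefore decide: the cone lies
  in the half-plane iff they agree.\<close>

lemma cone_decided_half_plane: "cone_decided half_plane"
  unfolding cone_decided_def
proof (intro exI allI impI)
  fix u :: "bool list" assume "2 \<le> length u"
  then obtain b c v where u: "u = b # c # v" by (auto simp: numeral_2_eq_2 Suc_le_length_iff)
  have "half_tree (c # v @ w) \<noteq> 0" for w by (rule half_tree_neq_0)
  then have "vertex (u @ w) \<in> half_plane \<longleftrightarrow> b = c" for w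
    using norm_half_tree_True[of "v @ w"] norm_half_tree_False[of "v @ w"] vertex_upper[of "u @ w"]
    unfolding u half_plane_def
    by (cases b; cases c) (auto simp: norm_divide divide_le_eq le_divide_eq simp del: half_tree.simps)
  then show "(\<forall>w. vertex (u @ w) \<in> half_plane) \<or> (\<forall>w. vertex (u @ w) \<notin> half_plane)"
    by blast
qed

text \<open>The map (z - 1) / z is the rotation of order three about \<open>rho\<close>; it takes
  the line Re z = 1/2 to the unit circle, because that line is equidistant from 0 and 1.\<close>

lemma cone_decided_half_plane': "cone_decided half_plane'"
proof (rule cone_decided_vimage[OF _ cone_decided_half_plane])
  show mod: "modular (\<lambda>z. (z - 1) / z)" by (rule modularI[of 1 0 "- 1" 1]) auto
  fix z assume z: "z \<in> upper_half_plane"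
  then have "z \<noteq> 0" by (auto simp: upper_half_plane_def)
  have "cmod z \<le> cmod (z - 1) \<longleftrightarrow> (cmod z)\<^sup>2 \<le> (cmod (z - 1))\<^sup>2"
    by (simp add: power2_le_iff_abs_le)
  also have "\<dots> \<longleftrightarrow> Re z \<le> 1 / 2"
    unfolding cmod_power2 by (simp add: power2_eq_square algebra_simps)
  finally show "z \<in> half_plane' \<longleftrightarrow> (z - 1) / z \<in> half_plane"
    using modular_mem[OF mod z] z \<open>z \<noteq> 0\<close>
    by (simp add: half_plane'_def half_plane_def norm_divide le_divide_eq)
qed

text \<open>The same argument with the rotation of order three about \<open>rho - 1\<close> and the
  points 0 and -1.\<close>

lemma cone_decided_half_plane'': "cone_decided half_plane''"
proof (rule cone_decided_vimage[OF _ cone_decided_half_plane])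
  show mod: "modular (\<lambda>z. (- z - 1) / z)" by (rule modularI[of "- 1" 0 "- 1" 1]) auto
  fix z assume z: "z \<in> upper_half_plane"
  then have "z \<noteq> 0" by (auto simp: upper_half_plane_def)
  have "cmod z \<le> cmod (- z - 1) \<longleftrightarrow> (cmod z)\<^sup>2 \<le> (cmod (- z - 1))\<^sup>2"
    by (simp add: power2_le_iff_abs_le)
  also have "\<dots> \<longleftrightarrow> Re z \<ge> - (1 / 2)"
    unfolding cmod_power2 by (auto simp: power2_eq_square algebra_simps)
  finally show "z \<in> half_plane'' \<longleftrightarrow> (- z - 1) / z \<in> half_plane"
    using modular_mem[OF mod z] z \<open>z \<noteq> 0\<close>
    by (simp add: half_plane''_def half_plane_def norm_divide le_divide_eq)
qed

lemma basic_half_plane_upper: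
  "K \<in> {half_plane, half_plane', half_plane''} \<Longrightarrow> K \<subseteq> upper_half_plane"
  by (auto simp: half_plane_def half_plane'_def half_plane''_def)

lemma half_plane_translate_upper: "K \<in> half_plane_translates \<Longrightarrow> K \<subseteq> upper_half_plane"
proof -
  assume "K \<in> half_plane_translates"
  then obtain \<gamma> K0 where "K = \<gamma> ` K0" "\<gamma> \<in> PSL2Z" "K0 \<in> {half_plane, half_plane', half_plane''}"
    by (auto simp: half_plane_translates_def)
  then show ?thesis using basic_half_plane_upper[of K0] modular_mem[OF modular_PSL2Z] by blast
qed

lemma cone_decided_translate:
  assumes "K \<in> half_plane_translates" shows "cone_decided K"
proof -
  obtain \<gamma> K0 where K: "K = \<gamma> ` K0" "modular \<gamma>" and K0: "K0 \<in> {half_plane, half_plane', half_plane''}"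
    using assms modular_PSL2Z by (auto simp: half_plane_translates_def)
  obtain g where g: "modular g" "\<And>z. z \<in> upper_half_plane \<Longrightarrow> g (\<gamma> z) = z"
    "\<And>z. z \<in> upper_half_plane \<Longrightarrow> \<gamma> (g z) = z"
    using modular_inv[OF K(2)] by blast
  have "z \<in> K \<longleftrightarrow> g z \<in> K0" if "z \<in> upper_half_plane" for z
    unfolding K(1) using g that basic_half_plane_upper[OF K0] by (metis image_iff subsetD)
  moreover have "cone_decided K0"
    using K0 cone_decided_half_plane cone_decided_half_plane' cone_decided_half_plane'' by auto
  ultimately show ?thesis using cone_decided_vimage g(1) by blast
qed

lemma cone_decided_Int:
  assumes "cone_decided K" "cone_decided K'" shows "cone_decided (K \<inter> K')"
proof -
  obtain N M where N: "\<And>u. N \<le> length u \<Longrightarrow> (\<forall>w. vertex (u @ w) \<in> K) \<or> (\<forall>w. vertex (u @ w) \<notin> K)"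
    and M: "\<And>u. M \<le> length u \<Longrightarrow> (\<forall>w. vertex (u @ w) \<in> K') \<or> (\<forall>w. vertex (u @ w) \<notin> K')"
    using assms unfolding cone_decided_def by blast
  have "(\<forall>w. vertex (u @ w) \<in> K \<inter> K') \<or> (\<forall>w. vertex (u @ w) \<notin> K \<inter> K')" if "N + M \<le> length u" for u
    using N[of u] M[of u] that by auto
  then show ?thesis unfolding cone_decided_def by blast
qed

lemma cone_decided_Inter:
  "finite \<F> \<Longrightarrow> (\<And>K. K \<in> \<F> \<Longrightarrow> cone_decided K) \<Longrightarrow> cone_decided (\<Inter>\<F>)"
proof (induction \<F> rule: finite_induct)
  case empty
  show ?case by (simp add: cone_decided_def)
next
  case (insert K \<F>)
  then show ?case using cone_decided_Int by simp
qed

lemma cone_decided_Omega: "cone_decided Omega"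
  unfolding cone_decided_def Omega_vertex by (intro exI[of _ 1]) auto

lemma cone_decided_upper: "cone_decided upper_half_plane"
  unfolding cone_decided_def
  by (intro exI[of _ 1] allI impI disjI1 vertex_upper) auto

lemma cone_decided_piece:
  assumes "convex_polyhedral_piece Omega S" shows "cone_decided S"
proof -
  obtain \<F> where "finite \<F>" "\<F> \<subseteq> half_plane_translates" "S = Omega \<inter> (upper_half_plane \<inter> \<Inter>\<F>)"
    using assms by (auto simp: convex_polyhedral_piece_def convex_polyhedral_def)
  then show ?thesis
    using cone_decided_Int cone_decided_Omega cone_decided_upper cone_decided_Inter
      cone_decided_translate by (metis subsetD)
qed

section \<open>Pieces moved by modular maps; single vertices and cones assembled from pieces\<close>

lemma half_plane_translate_image:
  assumes f: "modular f" and "K \<in> half_plane_translates" shows "f ` K \<in> half_plane_translates"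
proof -
  obtain \<gamma> K0 where K: "K = \<gamma> ` K0" "modular \<gamma>" and K0: "K0 \<in> {half_plane, half_plane', half_plane''}"
    using assms(2) modular_PSL2Z by (auto simp: half_plane_translates_def)
  have "f ` K = restrict (f \<circ> \<gamma>) upper_half_plane ` K0"
    unfolding K(1) image_image using basic_half_plane_upper[OF K0] by (intro image_cong) auto
  moreover have "restrict (f \<circ> \<gamma>) upper_half_plane \<in> PSL2Z"
    using modular_comp[OF f K(2)] by (simp add: modular_def)
  ultimately show ?thesis unfolding half_plane_translates_def using K0 by blast
qed

lemma basic_half_plane_translate:
  assumes "K \<in> {half_plane, half_plane', half_plane''}" shows "K \<in> half_plane_translates"
proof -
  have "K = restrict id upper_half_plane ` K"
    using basic_half_plane_upper[OF assms] by (auto simp: image_iff)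
  moreover have "restrict id upper_half_plane \<in> PSL2Z" using modular_id by (simp add: modular_def)
  ultimately show ?thesis unfolding half_plane_translates_def using assms by blast
qed

lemma convex_polyhedral_pieceI:
  assumes "finite \<F>" "\<F> \<subseteq> half_plane_translates"
    "\<And>z. z \<in> Omega \<Longrightarrow> z \<in> S \<longleftrightarrow> (\<forall>K\<in>\<F>. z \<in> K)" "S \<subseteq> Omega"
  shows "convex_polyhedral_piece Omega S"
proof -
  have "S = Omega \<inter> (upper_half_plane \<inter> \<Inter>\<F>)" using assms(3,4) Omega_upper by blast
  then show ?thesis unfolding convex_polyhedral_piece_def convex_polyhedral_def
    using assms(1,2) by blast
qed

text \<open>Allows pieces to be constructed at \<open>rho\<close> only and then carried to every
  other vertex.\<close>

lemma convex_polyhedral_piece_image: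
  assumes f: "modular f" and "convex_polyhedral_piece Omega S"
  shows "convex_polyhedral_piece Omega (f ` S)"
proof -
  obtain \<F> where F: "finite \<F>" "\<F> \<subseteq> half_plane_translates" and S: "S = Omega \<inter> (upper_half_plane \<inter> \<Inter>\<F>)"
    using assms(2) by (auto simp: convex_polyhedral_piece_def convex_polyhedral_def)
  obtain g where g: "modular g" "\<And>z. z \<in> upper_half_plane \<Longrightarrow> g (f z) = z"
    "\<And>z. z \<in> upper_half_plane \<Longrightarrow> f (g z) = z"
    using modular_inv[OF f] by blast
  show ?thesis
  proof (rule convex_polyhedral_pieceI)
    show "finite ((`) f ` \<F>)" using F by simp
    show "(`) f ` \<F> \<subseteq> half_plane_translates" using F half_plane_translate_image[OF f] by blast
    show "f ` S \<subseteq> Omega" using S modular_Omega[OF f] by blast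
    fix z assume z: "z \<in> Omega"
    note zu = Omega_upper[OF z]
    have in_image: "z \<in> f ` K \<longleftrightarrow> g z \<in> K" if "K \<subseteq> upper_half_plane" for K
      using g that zu by (metis image_iff subsetD)
    have "S \<subseteq> upper_half_plane" using S by blast
    then have "z \<in> f ` S \<longleftrightarrow> (\<forall>K\<in>\<F>. g z \<in> K)"
      using in_image[of S] S modular_Omega[OF g(1) z] modular_mem[OF g(1) zu] by auto
    also have "\<dots> \<longleftrightarrow> (\<forall>K\<in>\<F>. z \<in> f ` K)"
      by (intro ball_cong refl in_image[symmetric] half_plane_translate_upper subsetD[OF F(2)])
    finally show "z \<in> f ` S \<longleftrightarrow> (\<forall>K\<in>(`) f ` \<F>. z \<in> K)" by simp
  qed
qed

lemma half_tree_Omega: "half_tree w \<in> Omega"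
  by (auto simp: Omega_vertex intro!: image_eqI[of _ _ "True # w"])

lemma rho_Omega: "rho \<in> Omega"
  using half_tree_Omega[of "[]"] by simp

text \<open>This is the opposite closed side of the line bounding \<open>half_plane'\<close>, so the
  two half-planes together cut out that line.\<close>

lemma half_plane_Re_ge: "{z \<in> upper_half_plane. Re z \<ge> 1 / 2} \<in> half_plane_translates"
proof -
  have "{z \<in> upper_half_plane. Re z \<ge> 1 / 2} = (\<lambda>z. z + 1) ` half_plane''"
  proof (intro equalityI subsetI)
    fix z assume "z \<in> {z \<in> upper_half_plane. Re z \<ge> 1 / 2}"
    then show "z \<in> (\<lambda>z. z + 1) ` half_plane''"
      by (intro image_eqI[of _ _ "z - 1"]) (auto simp: half_plane''_def upper_half_plane_def)
  qed (auto simp: half_plane''_def upper_half_plane_def)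
  then show ?thesis
    using half_plane_translate_image[OF modular_shift] basic_half_plane_translate by simp
qed

lemma polyhedral_piece_rho: "convex_polyhedral_piece Omega {rho}"
  and polyhedral_piece_True: "convex_polyhedral_piece Omega (insert rho (range (\<lambda>w. half_tree (True # w))))"
proof -
  let ?K = "{z \<in> upper_half_plane. Re z \<ge> 1 / 2}"
  \<comment> \<open>A positive real part puts \<open>z\<close> in the \<open>True\<close> component,
    and norm at least 1 excludes the \<open>False\<close> branch below \<open>rho\<close>.\<close>
  have split: "z = rho \<or> (\<exists>w. z = half_tree (True # w))"
    if z: "z \<in> Omega" "Re z \<ge> 1 / 2" "cmod z \<ge> 1" for z
  proof -
    obtain v where "z = vertex v" "v \<noteq> []" using z(1) unfolding Omega_vertex by blast
    then obtain b w where v: "z = vertex (b # w)" by (cases v) auto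
    then have "b" using Re_vertex_False[of w] z(2) by (cases b) auto
    with v have "z = half_tree w" by simp
    then show ?thesis using norm_half_tree_False[of "tl w"] z(3)
      by (cases w; cases "hd w") (auto simp del: half_tree.simps(2))
  qed
  have rho: "Re rho = 1 / 2" "cmod rho = 1" by (simp add: rho_eq, rule norm_rho)
  have Re: "Re (half_tree (True # w)) > 1" for w using Re_half_tree[of w] by simp
  show "convex_polyhedral_piece Omega {rho}"
  proof (rule convex_polyhedral_pieceI[of "{half_plane, half_plane', ?K}"])
    fix z assume z: "z \<in> Omega"
    have "z = rho" if Re_z: "Re z = 1 / 2" and norm_z: "cmod z \<ge> 1"
    proof (rule ccontr)
      assume "z \<noteq> rho"
      then obtain w where "z = half_tree (True # w)" 
        using split[OF z eq_refl[OF Re_z[symmetric]] norm_z] by blast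
      with Re_z Re[of w] show False by (simp del: half_tree.simps)
    qed
    then show "z \<in> {rho} \<longleftrightarrow> (\<forall>K\<in>{half_plane, half_plane', ?K}. z \<in> K)"
      using Omega_upper[OF z] rho by (auto simp: half_plane_def half_plane'_def)
  qed (use half_plane_Re_ge basic_half_plane_translate rho_Omega in auto)
  show "convex_polyhedral_piece Omega (insert rho (range (\<lambda>w. half_tree (True # w))))"
  proof (rule convex_polyhedral_pieceI[of "{half_plane, ?K}"])
    fix z assume z: "z \<in> Omega"
    have "Re (half_tree (True # w)) \<ge> 1 / 2" "cmod (half_tree (True # w)) \<ge> 1" for w
      using Re[of w] norm_half_tree_True[of w] by linarith+
    then have "1 / 2 \<le> Re z \<and> 1 \<le> cmod z" if "z \<in> insert rho (range (\<lambda>w. half_tree (True # w)))"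
      using that rho by (auto simp del: half_tree.simps)
    then have "z \<in> insert rho (range (\<lambda>w. half_tree (True # w))) \<longleftrightarrow> 1 / 2 \<le> Re z \<and> 1 \<le> cmod z"
      using split[OF z] by blast
    then show "z \<in> insert rho (range (\<lambda>w. half_tree (True # w))) \<longleftrightarrow> (\<forall>K\<in>{half_plane, ?K}. z \<in> K)"
      using Omega_upper[OF z] by (simp add: half_plane_def conj_commute del: half_tree.simps)
  next
    show "insert rho (range (\<lambda>w. half_tree (True # w))) \<subseteq> Omega"
      using half_tree_Omega rho_Omega by blast
  qed (use half_plane_Re_ge basic_half_plane_translate in auto)
qed

lemma polyhedral_piece_False:
  "convex_polyhedral_piece Omega (insert rho (range (\<lambda>w. half_tree (False # w))))"
proof -
  \<comment> \<open>rotation of order three about rho\<close>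
  let ?f = "\<lambda>z :: complex. (z - 1) / z"
  have "modular ?f" by (rule modularI[of 1 0 "- 1" 1]) auto
  moreover have "?f rho = rho" using rho_square rho_neq_0 by (simp add: field_simps)
  moreover have "?f (half_tree (True # w)) = half_tree (False # w)" for w by simp
  ultimately show ?thesis
    using convex_polyhedral_piece_image[OF _ polyhedral_piece_True, of ?f]
    by (simp add: image_image del: half_tree.simps)
qed

lemma polyhedral_piece_vertex:
  assumes "w \<noteq> []" shows "convex_polyhedral_piece Omega {vertex w}"
proof -
  obtain f where "modular f" "\<And>v. vertex (w @ v) = f (half_tree v)" by (rule vertex_append[OF assms]) blast
  from this(2)[of "[]"] convex_polyhedral_piece_image[OF this(1) polyhedral_piece_rho]
  show ?thesis by simp
qed

text \<open>A half-plane containing the cone of a child also contains the parent, so a cone is a union of two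
  overlapping pieces rather than a single piece.\<close>

lemma polyhedral_piece_cone:
  assumes "u \<noteq> []"
  obtains S S' where "convex_polyhedral_piece Omega S" "convex_polyhedral_piece Omega S'"
    "S \<union> S' = range (\<lambda>w. vertex (u @ w))"
proof -
  obtain f where f: "modular f" "\<And>v. vertex (u @ v) = f (half_tree v)" by (rule vertex_append[OF assms]) blast
  let ?S = "\<lambda>b. insert rho (range (\<lambda>w. half_tree (b # w)))"
  have "range half_tree = ?S True \<union> ?S False"
  proof (intro equalityI subsetI)
    fix z assume "z \<in> range half_tree"
    then obtain w where "z = half_tree w" by blast
    then show "z \<in> ?S True \<union> ?S False"
      by (cases w; cases "hd w") (auto simp del: half_tree.simps(2))
  next
    fix z assume "z \<in> ?S True \<union> ?S False"
    moreover have "rho \<in> range half_tree" by (metis half_tree.simps(1) rangeI)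
    ultimately show "z \<in> range half_tree" by (auto simp del: half_tree.simps(2))
  qed
  then have "f ` ?S True \<union> f ` ?S False = range (\<lambda>w. vertex (u @ w))"
    unfolding f(2) image_Un[symmetric] by (metis image_image)
  then show thesis
    using that convex_polyhedral_piece_image[OF f(1)] polyhedral_piece_True polyhedral_piece_False
    by blast
qed


section \<open>Transport of permutations of the orbit to words\<close>

definition word_code :: "(complex \<Rightarrow> complex) \<Rightarrow> bool list \<Rightarrow> bool list" where
  "word_code g w = (if w = [] then [] else inv_into {w. w \<noteq> []} vertex (g (vertex w)))"

lemma vertex_bij_betw: "bij_betw vertex {w. w \<noteq> []} Omega"
  by (simp add: bij_betw_def inj_on_vertex Omega_vertex)

lemma vertex_eq_iff: "u \<noteq> [] \<Longrightarrow> v \<noteq> [] \<Longrightarrow> vertex u = vertex v \<longleftrightarrow> u = v"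
  using inj_on_vertex by (auto dest: inj_onD)

lemma word_code_Nil [simp]: "word_code g [] = []"
  by (simp add: word_code_def)

lemma vertex_Omega: "w \<noteq> [] \<Longrightarrow> vertex w \<in> Omega"
  by (auto simp: Omega_vertex)

lemma word_code_eqI: "u \<noteq> [] \<Longrightarrow> v \<noteq> [] \<Longrightarrow> g (vertex u) = vertex v \<Longrightarrow> word_code g u = v"
  by (simp add: word_code_def inv_into_f_f[OF inj_on_vertex])

lemma word_code_vertex:
  assumes "g \<in> Bij Omega" "w \<noteq> []"
  shows "word_code g w \<noteq> []" "vertex (word_code g w) = g (vertex w)"
proof -
  have "g (vertex w) \<in> Omega" using Bij_imp_funcset[OF assms(1)] vertex_Omega[OF assms(2)] by blast
  then obtain v where "v \<noteq> []" "g (vertex w) = vertex v" by (auto simp: Omega_vertex)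
  with word_code_eqI[OF assms(2)] show "word_code g w \<noteq> []" "vertex (word_code g w) = g (vertex w)"
    by auto
qed

lemma bij_word_code:
  assumes "g \<in> Bij Omega" shows "bij (word_code g)"
proof (rule bijI)
  have g: "inj_on g Omega" "g ` Omega = Omega" using assms by (auto simp: Bij_def bij_betw_def)
  show "inj (word_code g)"
  proof (rule injI)
    fix u v assume eq: "word_code g u = word_code g v"
    show "u = v"
    proof (cases "u = [] \<or> v = []")
      case True
      then show ?thesis using eq word_code_vertex(1)[OF assms] by (metis word_code_Nil)
    next
      case False
      then have "g (vertex u) = g (vertex v)" using eq word_code_vertex(2)[OF assms] by metis
      then have "vertex u = vertex v" using False g(1) vertex_Omega by (auto dest: inj_onD)
      then show ?thesis using False vertex_eq_iff by blast
    qed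
  qed
  have "\<exists>u. v = word_code g u" for v
  proof (cases "v = []")
    case True
    then show ?thesis by (intro exI[of _ "[]"]) simp
  next
    case False
    then obtain z where "z \<in> Omega" "g z = vertex v" using g(2) vertex_Omega by (metis imageE)
    then obtain u where "u \<noteq> []" "g (vertex u) = vertex v" by (auto simp: Omega_vertex)
    then show ?thesis using word_code_eqI False by metis
  qed
  then show "surj (word_code g)" unfolding surj_def by blast
qed

lemma word_code_compose:
  assumes "g \<in> Bij Omega" "h \<in> Bij Omega"
  shows "word_code (compose Omega g h) = word_code g \<circ> word_code h"
proof
  fix w show "word_code (compose Omega g h) w = (word_code g \<circ> word_code h) w"
  proof (cases "w = []")
    case False
    then show ?thesis
      using word_code_vertex[OF assms(1)] word_code_vertex[OF assms(2)] vertex_Omega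
      by (intro word_code_eqI) (auto simp: compose_eq)
  qed simp
qed

lemma word_code_id: "word_code (\<lambda>x\<in>Omega. x) = id"
proof
  fix w show "word_code (\<lambda>x\<in>Omega. x) w = id w"
    using vertex_Omega[of w] by (cases "w = []") (auto intro: word_code_eqI)
qed

lemma word_code_onto:
  assumes "bij s" "s [] = []"
  obtains g where "g \<in> Bij Omega" "word_code g = s"
proof
  let ?X = "{w :: bool list. w \<noteq> []}"
  let ?g = "\<lambda>z\<in>Omega. vertex (s (inv_into ?X vertex z))"
  \<comment> \<open>Fixing the empty word is what makes \<open>s\<close> restrict to the nonempty
    words.\<close>
  have "bij_betw s (UNIV - {[]}) (UNIV - {s []})"
    using assms(1) by (intro bij_betw_DiffI) (auto simp: bij_betw_def)
  then have s: "bij_betw s ?X ?X" using assms(2) by (simp add: Collect_neg_eq Compl_eq_Diff_UNIV)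
  have "bij_betw (vertex \<circ> (s \<circ> inv_into ?X vertex)) Omega Omega"
    by (rule bij_betw_trans[OF bij_betw_trans[OF bij_betw_inv_into[OF vertex_bij_betw] s] vertex_bij_betw])
  then have "bij_betw ?g Omega Omega"
    by (rule bij_betw_cong[THEN iffD1, rotated]) simp
  then show "?g \<in> Bij Omega" by (simp add: Bij_def)
  show "word_code ?g = s"
  proof
    fix w show "word_code ?g w = s w"
    proof (cases "w = []")
      case False
      then have "s w \<noteq> []" using s by (auto simp: bij_betw_def)
      moreover have "inv_into ?X vertex (vertex w) = w"
        using False by (simp add: inv_into_f_f[OF inj_on_vertex])
      ultimately show ?thesis using False vertex_Omega by (intro word_code_eqI) auto
    qed (simp add: assms(2))
  qed
qed

text \<open>A deep cone whose top vertex lies in a piece lies in it entirely, so \<open>g\<close>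
  acts on that cone as one modular map, and such a map keeps tails.\<close>

lemma tail_preserving_if_piecewise_isometric:
  assumes g: "g \<in> Bij Omega" and pw: "piecewise_isometric Omega g"
  shows "\<exists>N. tail_preserving_from N (word_code g)"
proof -
  obtain \<S> where S: "finite \<S>" "\<forall>S\<in>\<S>. convex_polyhedral_piece Omega S" "Omega = \<Union>\<S>"
    "\<forall>S\<in>\<S>. \<exists>\<gamma>\<in>PSL2Z. \<forall>z\<in>S. g z = \<gamma> z"
    using pw unfolding piecewise_isometric_def by (elim exE conjE) (rule that)
  have "\<exists>N. \<forall>u. N \<le> length u \<longrightarrow> vertex u \<in> S \<longrightarrow>
      (\<forall>w. word_code g (u @ w) = word_code g u @ w)" if S_in: "S \<in> \<S>" for S
  proof -
    obtain N where N: "\<And>u. N \<le> length u \<Longrightarrow> (\<forall>w. vertex (u @ w) \<in> S) \<or> (\<forall>w. vertex (u @ w) \<notin> S)"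
      using cone_decided_piece[OF bspec[OF S(2) S_in]] unfolding cone_decided_def by blast
    obtain \<gamma> where \<gamma>: "modular \<gamma>" "\<And>z. z \<in> S \<Longrightarrow> g z = \<gamma> z"
      using bspec[OF S(4) S_in] modular_PSL2Z by blast
    obtain s M where s: "tail_preserving_from M s"
      "\<And>w. w \<noteq> [] \<Longrightarrow> s w \<noteq> [] \<and> \<gamma> (vertex w) = vertex (s w)"
      using modular_acts_on_words[OF \<gamma>(1)] unfolding acts_on_words_def by blast
    have "word_code g (u @ w) = word_code g u @ w"
      if u: "Suc (N + M) \<le> length u" and "vertex u \<in> S" for u w
    proof -
      have in_S: "vertex (u @ w) \<in> S" for w
        using N[of u] u \<open>vertex u \<in> S\<close> by (metis Suc_leD add_leD1 append_Nil2)
      have "word_code g (u @ w) = s (u @ w)" for w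
      proof (rule word_code_eqI)
        show ne: "u @ w \<noteq> []" using u by auto
        show "s (u @ w) \<noteq> []" "g (vertex (u @ w)) = vertex (s (u @ w))"
          using s(2)[OF ne] \<gamma>(2)[OF in_S] by simp_all
      qed
      from this[of w] this[of "[]"] show ?thesis
        using tail_preserving_fromD[OF s(1), of u w] u by simp
    qed
    then show ?thesis by blast
  qed
  then obtain N where N: "\<And>S u w. S \<in> \<S> \<Longrightarrow> N S \<le> length u \<Longrightarrow> vertex u \<in> S \<Longrightarrow>
      word_code g (u @ w) = word_code g u @ w" by metis
  \<comment> \<open>The sum serves as a common bound for the thresholds of the finitely many pieces;
    \<open>Suc\<close> ensures that \<open>u\<close> names a vertex.\<close>
  have "tail_preserving_from (Suc (\<Sum>S\<in>\<S>. N S)) (word_code g)"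
    unfolding tail_preserving_from_def
  proof (intro allI impI)
    fix u w :: "bool list" assume u: "Suc (\<Sum>S\<in>\<S>. N S) \<le> length u"
    then have "vertex u \<in> Omega" by (intro vertex_Omega) auto
    then obtain S' where S': "S' \<in> \<S>" "vertex u \<in> S'" using S(3) by blast
    moreover have "N S' \<le> length u" using member_le_sum[OF S'(1), of N] S(1) u by simp
    ultimately show "word_code g (u @ w) = word_code g u @ w" using N by blast
  qed
  then show ?thesis by blast
qed

text \<open>If \<open>f\<close> and \<open>f'\<close> parametrise two cones by the half tree, the
  quotient of the two carries one cone to the other and preserves tails.\<close>

lemma PSL2Z_transition:
  assumes "modular f" "modular f'"
  obtains \<gamma> where "\<gamma> \<in> PSL2Z" "\<And>z. z \<in> upper_half_plane \<Longrightarrow> \<gamma> (f z) = f' z"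
proof -
  obtain h where h: "modular h" "\<And>z. z \<in> upper_half_plane \<Longrightarrow> h (f z) = z"
    by (rule modular_inv[OF assms(1)]) blast
  show thesis
  proof
    show "restrict (f' \<circ> h) upper_half_plane \<in> PSL2Z"
      using modular_comp[OF assms(2) h(1)] by (simp add: modular_def)
    show "restrict (f' \<circ> h) upper_half_plane (f z) = f' z" if "z \<in> upper_half_plane" for z
      using that h modular_mem[OF assms(1)] by simp
  qed
qed

lemma piecewise_isometric_if_tail_preserving:
  assumes g: "g \<in> Bij Omega" and tp: "tail_preserving_from N (word_code g)"
  shows "piecewise_isometric Omega g"
proof -
  define good where "good S \<longleftrightarrow> convex_polyhedral_piece Omega S \<and> (\<exists>\<gamma>\<in>PSL2Z. \<forall>z\<in>S. g z = \<gamma> z)" for S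
  \<comment> \<open>Cones are taken at length \<open>Suc N\<close> rather than \<open>N\<close>, so
    that their base words are nonempty even if \<open>N = 0\<close>; shorter words contribute single
    vertices.\<close>
  define W where "W = {u :: bool list. u \<noteq> [] \<and> length u < Suc (Suc N)}"
  \<comment> \<open>Two sets are needed for a cone; a single vertex uses the same piece twice, so
    both cases fit one statement.\<close>
  have cover: "\<exists>S S'. good S \<and> good S' \<and> vertex u \<in> S \<union> S' \<and>
      (length u = Suc N \<longrightarrow> (\<forall>w. vertex (u @ w) \<in> S \<union> S'))" if u: "u \<noteq> []" for u
  proof -
    obtain f where f: "modular f" "\<And>w. vertex (u @ w) = f (half_tree w)" by (rule vertex_append[OF u]) blast
    obtain f' where f': "modular f'" "\<And>w. vertex (word_code g u @ w) = f' (half_tree w)"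
      by (rule vertex_append[OF word_code_vertex(1)[OF g u]]) blast
    obtain \<gamma> where \<gamma>: "\<gamma> \<in> PSL2Z" "\<And>z. z \<in> upper_half_plane \<Longrightarrow> \<gamma> (f z) = f' z"
      using PSL2Z_transition[OF f(1) f'(1)] by blast
    \<comment> \<open>This one \<open>\<gamma>\<close> agrees with \<open>g\<close> at
      \<open>vertex u\<close>, and on the whole cone as soon as \<open>word_code g\<close> keeps the
      tails behind \<open>u\<close>.\<close>
    have \<gamma>_cone: "\<gamma> (vertex (u @ w)) = vertex (word_code g u @ w)" for w
      unfolding f(2) f'(2) using \<gamma>(2)[OF half_tree_upper] .
    show ?thesis
    proof (cases "length u = Suc N")
      case False
      have "\<gamma> (vertex u) = g (vertex u)" using \<gamma>_cone[of "[]"] word_code_vertex[OF g u] by simp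
      then have "\<forall>z\<in>{vertex u}. g z = \<gamma> z" by simp
      then have "good {vertex u}"
        using polyhedral_piece_vertex[OF u] \<gamma>(1) unfolding good_def by blast
      with False show ?thesis by blast
    next
      case True
      obtain S S' where S: "convex_polyhedral_piece Omega S" "convex_polyhedral_piece Omega S'"
        "S \<union> S' = range (\<lambda>w. vertex (u @ w))" using polyhedral_piece_cone[OF u] by blast
      have "g (vertex (u @ w)) = \<gamma> (vertex (u @ w))" for w
        unfolding \<gamma>_cone
        using word_code_vertex(2)[OF g, of "u @ w"] u True tail_preserving_fromD[OF tp, of u w] by simp
      then have "g z = \<gamma> z" if "z \<in> S \<union> S'" for z using that unfolding S(3) by auto
      then have "good S" "good S'" using S(1,2) \<gamma>(1) by (auto simp: good_def)
      moreover have "vertex (u @ w) \<in> S \<union> S'" for w unfolding S(3) by blast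
      moreover from this[of "[]"] have "vertex u \<in> S \<union> S'" by simp
      ultimately show ?thesis by blast
    qed
  qed
  then obtain A B where AB: "\<And>u. u \<noteq> [] \<Longrightarrow> good (A u) \<and> good (B u) \<and> vertex u \<in> A u \<union> B u \<and>
      (length u = Suc N \<longrightarrow> (\<forall>w. vertex (u @ w) \<in> A u \<union> B u))" by metis
  let ?\<S> = "A ` W \<union> B ` W"
  have "finite W" unfolding W_def by (rule finite_subset[OF _ finite_short_words]) auto
  then have "finite ?\<S>" by simp
  moreover have good: "good S" if "S \<in> ?\<S>" for S using that AB by (auto simp: W_def)
  moreover have "Omega = \<Union>?\<S>"
  proof (intro equalityI subsetI)
    fix z assume "z \<in> Omega"
    then obtain v where v: "v \<noteq> []" "z = vertex v" by (auto simp: Omega_vertex)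
    let ?u = "take (Suc N) v"
    have u: "?u \<in> W" "?u \<noteq> []" using v by (auto simp: W_def)
    have "z \<in> A ?u \<union> B ?u"
    proof (cases "length v < Suc N")
      case True
      then show ?thesis using AB[OF u(2)] v by simp
    next
      case False
      then have "\<forall>w. vertex (?u @ w) \<in> A ?u \<union> B ?u" using AB[OF u(2)] by simp
      from spec[OF this, of "drop (Suc N) v"] show ?thesis
        unfolding v(2) append_take_drop_id .
    qed
    with u show "z \<in> \<Union>?\<S>" by blast
  next
    fix z assume "z \<in> \<Union>?\<S>"
    then show "z \<in> Omega" using good unfolding good_def convex_polyhedral_piece_def by blast
  qed
  ultimately show ?thesis unfolding piecewise_isometric_def good_def by (intro exI[of _ ?\<S>]) blast
qed

lemma carrier_phi: "carrier (phi Omega) = {g \<in> Bij Omega. word_code g \<in> word_perms}"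
  using tail_preserving_if_piecewise_isometric piecewise_isometric_if_tail_preserving bij_word_code
  by (auto simp: phi_def word_perms_def)

lemma group_phi: "group (phi Omega)"
proof -
  let ?C = "{g \<in> Bij Omega. word_code g \<in> word_perms}"
  have "subgroup ?C (BijGroup Omega)"
  proof (rule subgroup.intro)
    show "?C \<subseteq> carrier (BijGroup Omega)" by (auto simp: BijGroup_def)
    show "x \<otimes>\<^bsub>BijGroup Omega\<^esub> y \<in> ?C" if "x \<in> ?C" "y \<in> ?C" for x y
      using that by (simp add: BijGroup_def compose_Bij word_code_compose word_perms_comp)
    show "\<one>\<^bsub>BijGroup Omega\<^esub> \<in> ?C"
      using id_Bij by (simp add: BijGroup_def word_code_id word_perms_id)
    show "inv\<^bsub>BijGroup Omega\<^esub> x \<in> ?C" if x: "x \<in> ?C" for x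
    proof -
      let ?y = "\<lambda>z\<in>Omega. inv_into Omega x z"
      have y: "?y \<in> Bij Omega" using x restrict_inv_into_Bij by blast
      have "word_code ?y \<circ> word_code x = id"
        using word_code_compose[OF y, of x] x Bij_compose_restrict_eq[of x Omega] by (simp add: word_code_id)
      moreover have "word_code x \<circ> inv_into UNIV (word_code x) = id"
        using x word_perms_inv_comp by blast
      \<comment> \<open>A left inverse and a right inverse of the same map coincide.\<close>
      ultimately have "word_code ?y = inv_into UNIV (word_code x)"
        by (metis comp_assoc comp_id id_comp)
      then show ?thesis using x y word_perms_inv[of "word_code x"] by (simp add: inv_BijGroup)
    qed
  qed
  then have "group ((BijGroup Omega)\<lparr>carrier := ?C\<rparr>)"
    using group_BijGroup by (rule subgroup.subgroup_is_group)
  moreover have "phi Omega = (BijGroup Omega)\<lparr>carrier := ?C\<rparr>"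
    using carrier_phi by (simp add: phi_def)
  ultimately show ?thesis by simp
qed

lemma finite_support_word_code:
  assumes "g \<in> Bij Omega"
  shows "finite {w. word_code g w \<noteq> w} \<longleftrightarrow> finite {z \<in> Omega. g z \<noteq> z}"
proof -
  have iff: "g (vertex w) \<noteq> vertex w \<longleftrightarrow> word_code g w \<noteq> w" if "w \<noteq> []" for w
    using word_code_vertex[OF assms that] that vertex_eq_iff by metis
  have "{z \<in> Omega. g z \<noteq> z} = vertex ` {w. w \<noteq> [] \<and> word_code g w \<noteq> w}"
    using iff by (auto simp: Omega_vertex)
  also have "{w. w \<noteq> [] \<and> word_code g w \<noteq> w} = {w. word_code g w \<noteq> w}" by auto
  finally have "{z \<in> Omega. g z \<noteq> z} = vertex ` {w. word_code g w \<noteq> w}" .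
  moreover have "inj_on vertex {w. word_code g w \<noteq> w}"
    by (rule inj_on_subset[OF inj_on_vertex]) auto
  ultimately show ?thesis by (simp add: finite_image_iff)
qed

theorem theorem2p4:
  shows "finitely_supported_perms Omega \<lhd> phi Omega
       \<and> (phi Omega Mod finitely_supported_perms Omega) \<cong> Thompson_V"
proof -
  let ?h = "\<lambda>g. boundary_map (word_code g)"
  have "?h \<in> hom (phi Omega) Thompson_V"
  proof (rule homI)
    show "?h g \<in> carrier Thompson_V" if "g \<in> carrier (phi Omega)" for g
      using that by (simp add: carrier_phi carrier_Thompson_V)
    show "?h (x \<otimes>\<^bsub>phi Omega\<^esub> y) = ?h x \<otimes>\<^bsub>Thompson_V\<^esub> ?h y"
      if "x \<in> carrier (phi Omega)" "y \<in> carrier (phi Omega)" for x y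
    proof -
      have "x \<otimes>\<^bsub>phi Omega\<^esub> y = compose Omega x y"
        using that by (simp add: carrier_phi) (simp add: phi_def BijGroup_def)
      then show ?thesis using that by (simp add: carrier_phi word_code_compose mult_Thompson_V)
    qed
  qed
  then interpret h: group_hom "phi Omega" Thompson_V ?h
    by (intro group_hom.intro group_phi group_Thompson_V group_hom_axioms.intro)
  \<comment> \<open>Besides comparing supports, this must show that a finitely supported permutation
    is piecewise isometric at all; \<open>word_perms_if_finite_support\<close> supplies
    that.\<close>
  have "kernel (phi Omega) Thompson_V ?h = finitely_supported_perms Omega"
    using boundary_map_eq_id_iff finite_support_word_code bij_word_code word_perms_if_finite_support
    by (fastforce simp: kernel_def carrier_phi one_Thompson_V finitely_supported_perms_def)
  moreover have "?h ` carrier (phi Omega) = carrier Thompson_V"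
  proof (intro equalityI subsetI)
    fix f assume "f \<in> carrier Thompson_V"
    then obtain s where s: "s \<in> word_perms" "f = boundary_map s" by (auto simp: carrier_Thompson_V)
    then obtain g where "g \<in> Bij Omega" "word_code g = s"
      using word_code_onto[of s] by (auto simp: word_perms_def)
    with s show "f \<in> ?h ` carrier (phi Omega)" by (auto simp: carrier_phi)
  qed (auto simp: h.hom_closed)
  ultimately show ?thesis using h.normal_kernel h.FactGroup_iso by metis
qed

end
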